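(* Consider the system $x(t+1)=f(x(t),u(t))+w(t)$, $y(t)=h(x(t),u(t))+v(t)$ with $f,h$ continuous and $x(t)\in\mathbb X$, $u(t)\in\mathbb U$ for all $t\in\mathbb I_{\ge 0}$, where $\mathbb X\subset\mathbb R^n$ and $\mathbb U\subset\mathbb R^m$ are compact. Let the posterior means $m_{+,x},m_{+,y}$ and posterior variances of the Gaussian process (GP) models be as in the context. Suppose the following detectability assumption holds for the learned system $x(t+1)=m_{+,x}(d(t)|D^d,Y^d)+\check w(t)$, $y(t)=m_{+,y}(d(t)|D^d,Y^d)+\check v(t)$: there exist a function $W_\delta:\mathbb R^n\times\mathbb R^n\to\mathbb R_{\ge0}$, a constant $\eta\in[0,1)$ and symmetric positive definite matrices $P_1,P_2,Q_0,R_0$ such that $$\|x-\tilde x\|_{P_1}^2\le W_\delta(x,\tilde x)\le\|x-\tilde x\|_{P_2}^2,$$ $$W_\delta\big(m_{+,x}(d|D^d,Y^d)+\check w,\;m_{+,x}(\tilde d|D^d,Y^d)+\check w'\big)\le \eta W_\delta(x,\tilde x)+\|\check w-\check w'\|^2_{Q_{\min}^{-1}}+\|m_{+,y}(d|D^d,Y^d)-m_{+,y}(\tilde d|D^d,Y^d)\|^2_{R_{\min}^{-1}}$$ for all $(x,u,\check w)$, $(\tilde x,u,\check w')$ with $x,\tilde x\in\mathbb X$, $u\in\mathbb U$ and $\check w,\check w'\in\mathbb R^n$, where $d=[x^\top\ u^\top]^\top$, $\tilde d=[\tilde x^\top\ u^\top]^\top$, and $Q_{\min}^{-1},R_{\min}^{-1}$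 are the matrices defined in the context (which depend on $Q_0,R_0$). Let the GP based moving horizon estimator (MHE) defined in the context be designed with these $\eta,P_2,Q_0,R_0$. Then there exist $\mu\in[0,1)$ and a minimal horizon length $\bar M$ such that for all horizon lengths $M\in\mathbb I_{\ge\bar M}$, the state estimate $\hat x(t)$ of the GP based MHE satisfies, for all $t\in\mathbb I_{\ge0}$ (for all $x(0),\hat x(0)\in\mathbb X$ and every trajectory $(x(t),u(t),w(t),v(t))_{t=0}^\infty$ of the system with $x(t)\in\mathbb X$ and $u(t)\in\mathbb U$ for all $t$), $$\|\hat x(t)-x(t)\|_{P_1}\le\max\Big\{6\sqrt{\mu}^{\,t}\|\hat x(0)-x(0)\|_{P_2},\ \max_{q\in\mathbb I_{[0,t-1]}}\tfrac{12}{1-\sqrt[4]{\mu}}\sqrt[4]{\mu}^{\,q}\|w(t-q-1)\|_{Q_{\max}^{-1}},\ \max_{q\in\mathbb I_{[0,t-1]}}\tfrac{12}{1-\sqrt[4]{\mu}}\sqrt[4]{\mu}^{\,q}\|v(t-q-1)\|_{R_{\max}^{-1}},\ \tfrac{12}{1-\sqrt[4]{\mu}}\alpha^{\max}\Big\},$$ where $Q_{\max}^{-1},R_{\max}^{-1},\alpha^{\max}$ are defined in the context. Consequently, the GP based MHE is practically robustly exponentially stable (pRES), as defined in the context.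
   Context: **Notation.** $\mathbb I_{\ge a}$ is the set of integers $\ge a$, and $\mathbb I_{[a,b]}$ the set of integers in $[a,b]$. For symmetric positive definite $P$, $\|x\|_P=\sqrt{x^\top P x}$. For symmetric $A,B$, $A\le B$ means that $B-A$ is positive semidefinite. Conventions: $0^0=1$; a maximum over an empty index set (at $t=0$) is omitted. **System.** $x(t),w(t)\in\mathbb R^n$, $u(t)\in\mathbb R^m$, $y(t),v(t)\in\mathbb R^p$; $\mathbb X,\mathbb U$ are nonempty compact sets; $f=(f_1,\dots,f_n)$ and $h=(h_1,\dots,h_p)$ are continuous. The regression input is $d(t)=[x(t)^\top\ u(t)^\top]^\top\in\mathbb R^{n_d}$, $n_d=n+m$. **GP models.** One independent scalar GP is used for each of the $n$ components of $f$ and $p$ components of $h$, each with prior mean $0$, its own hyperparameters and its own scalar training outputs. For each GP the kernel is the squared exponential ARD kernel $$k(d_i,d_j)=\sigma_f^2\exp\big(-\tfrac12(d_i-d_j)^\top\Lambda^{-1}(d_i-d_j)\big)+\sigma_\varepsilon^2\delta_{ij},$$ with $\sigma_f,\sigma_\varepsilon\ge0$ and $\Lambda=\mathrm{diag}(\varphi_1^2,\dots,\varphi_{n_d}^2)$, where $\delta_{ij}$ is the Kronecker delta in the data indices (a test input carries its own index, different from all training indices), and the hyperparameters are such that all inverses used exist. Given training inputs $D^d=[d_1^d\ \dots\ d_N^d]$ and training outputs $Y^d=(y_1^d,\dots,y_N^d)$ (used as a column vector; all training data are fixed), the posterior mean and variance at a test input $d_*$ are $$m_+(d_*|D^d,Y^d)=k(d_*,D^d)(K(D^d,D^d)+\sigma_\varepsilon^2I)^{-1}Y^d,$$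 $$\sigma_+^2(d_*|D^d,Y^d)=k(d_*,d_* )-k(d_*,D^d)(K(D^d,D^d)+\sigma_\varepsilon^2I)^{-1}k(D^d,d_* ),$$ where $k(d_*,D^d)=(k(d_*,d_i^d))_i\in\mathbb R^{1\times N}$, $k(D^d,d_* )=k(d_*,D^d)^\top$, $K(D^d,D^d)=(k(d_i^d,d_j^d))_{i,j}$. The quantities for the GP of $f_i$ are denoted $m_{+,x_i},\sigma_{+,x_i}^2,\sigma_{f,x_i},\sigma_{\varepsilon,x_i}$, and for the GP of $h_j$ by $m_{+,y_j},\sigma_{+,y_j}^2,\sigma_{f,y_j},\sigma_{\varepsilon,y_j}$. Stacked vectors: $m_{+,x}=(m_{+,x_1},\dots,m_{+,x_n})^\top$, $m_{+,y}=(m_{+,y_1},\dots,m_{+,y_p})^\top$. **Weighting matrices.** For a regression input $d$ and symmetric positive definite $Q_0\in\mathbb R^{n\times n}$, $R_0\in\mathbb R^{p\times p}$: $Q_d=\mathrm{diag}(\sigma_{+,x_1}^2(d|D^d,Y^d),\dots,\sigma_{+,x_n}^2(d|D^d,Y^d))+Q_0$ and $R_d=\mathrm{diag}(\sigma_{+,y_1}^2(d|D^d,Y^d),\dots,\sigma_{+,y_p}^2(d|D^d,Y^d))+R_0$. Moreover $Q_{\min}^{-1}=[\mathrm{diag}(\sigma_{f,x_1}^2+\sigma_{\varepsilon,x_1}^2,\dots,\sigma_{f,x_n}^2+\sigma_{\varepsilon,x_n}^2)+Q_0]^{-1}$, $R_{\min}^{-1}=[\mathrm{diag}(\sigma_{f,y_1}^2+\sigma_{\varepsilon,y_1}^2,\dots,\sigma_{f,y_p}^2+\sigma_{\varepsilon,y_p}^2)+R_0]^{-1}$,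 $Q_{\max}^{-1}=Q_0^{-1}$, $R_{\max}^{-1}=R_0^{-1}$, so that $Q_{\min}^{-1}\le Q_d^{-1}\le Q_{\max}^{-1}$ and $R_{\min}^{-1}\le R_d^{-1}\le R_{\max}^{-1}$ for all $d$. **GP based MHE.** Let $M$ be the horizon length, $M_t=\min\{t,M\}$, and $\hat x(0)\in\mathbb X$ a given initial estimate. At each time $t$, given the inputs $u(j)$ and measured outputs $y(j)$, $j\in\mathbb I_{[t-M_t,t-1]}$, and the past estimate $\hat x(t-M_t)$, minimize over $\bar x(t-M_t|t)$ and $\bar w(\cdot|t)$ the cost $$J=2\eta^{M_t}\|\bar x(t-M_t|t)-\hat x(t-M_t)\|_{P_2}^2+\sum_{j=1}^{M_t}2\eta^{j-1}\Big(\|\bar w(t-j|t)\|^2_{Q^{-1}_{\bar d(t-j|t)}}+\|\bar v(t-j|t)\|^2_{R^{-1}_{\bar d(t-j|t)}}\Big)$$ subject to $\bar x(j+1|t)=m_{+,x}(\bar d(j|t)|D^d,Y^d)+\bar w(j|t)$ and $y(j)=m_{+,y}(\bar d(j|t)|D^d,Y^d)+\bar v(j|t)$ for all $j\in\mathbb I_{[t-M_t,t-1]}$, and $\bar x(j|t)\in\mathbb X$ for all $j\in\mathbb I_{[t-M_t,t]}$, where $\bar d(j|t)=[\bar x(j|t)^\top\ u(j)^\top]^\top$. With $\hat x(\cdot|t)$ an optimal state sequence, the estimate is $\hat x(t):=\hat x(t|t)$. **Model mismatch.** With $d=[x^\top\ u^\top]^\top$, $\alpha_1^{\max}=\max_{x\in\mathbb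 X,u\in\mathbb U}\|f(x,u)-m_{+,x}(d|D^d,Y^d)\|_{Q_{\max}^{-1}}$, $\alpha_2^{\max}=\max_{x\in\mathbb X,u\in\mathbb U}\|h(x,u)-m_{+,y}(d|D^d,Y^d)\|_{R_{\max}^{-1}}$, $\alpha^{\max}=\max\{\alpha_1^{\max},\alpha_2^{\max}\}$. **pRES.** A state estimator for the system is practically robustly exponentially stable if there exist $C_1,C_2,C_3>0$, $\lambda_1,\lambda_2,\lambda_3\in[0,1)$ and $\alpha>0$ such that its estimates satisfy $$\|x(t)-\hat x(t)\|\le\max\Big\{C_1\|x(0)-\hat x(0)\|\lambda_1^t,\ \max_{j\in\mathbb I_{[0,t-1]}}C_2\|w(j)\|\lambda_2^{t-j-1},\ \max_{j\in\mathbb I_{[0,t-1]}}C_3\|v(j)\|\lambda_3^{t-j-1},\ \alpha\Big\}$$ for all $t\in\mathbb I_{\ge0}$, all $x(0),\hat x(0)\in\mathbb X$, and every trajectory $(x(t),u(t),w(t),v(t))_{t=0}^\infty$ satisfying the system dynamics (with $x(t)\in\mathbb X$, $u(t)\in\mathbb U$ for all $t$). *)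

theory Defs
  imports "HOL-Analysis.Analysis"
begin

definition diag_matrix :: "real^'k \<Rightarrow> real^'k^'k" where
  "diag_matrix v = (\<chi> i j. if i = j then v $ i else 0)"

definition sym_pos_def :: "real^'k^'k \<Rightarrow> bool" where
  "sym_pos_def P \<longleftrightarrow> transpose P = P \<and> (\<forall>x. x \<noteq> 0 \<longrightarrow> x \<bullet> (P *v x) > 0)"

definition wnorm :: "real^'k^'k \<Rightarrow> real^'k \<Rightarrow> real" where
  "wnorm P x = sqrt (x \<bullet> (P *v x))"

definition stack :: "real^'n \<Rightarrow> real^'m \<Rightarrow> real^('n + 'm)" where
  "stack x u = (\<chi> k. case k of Inl i \<Rightarrow> x $ i | Inr j \<Rightarrow> u $ j)"

text \<open>A scalar Gaussian process with prior mean zero: the hyperparameters of its kernel and its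
  training outputs. The type \<open>'d\<close> indexes the components of a regression input and \<open>'N\<close> indexes the
  training data. The training inputs are shared by all processes and are passed separately.\<close>

record ('d, 'N) gp =
  sigma_f :: real
  sigma_eps :: real
  lengths :: "real^'d"
  outputs :: "real^'N"

definition gp_Lambda :: "('d::finite, 'N::finite) gp \<Rightarrow> real^'d^'d" where
  "gp_Lambda g = diag_matrix (\<chi> k. (lengths g $ k)\<^sup>2)"

text \<open>The Kronecker delta in the kernel compares data indices, not inputs, so the kernel takes
  inputs tagged with their index: \<open>Some i\<close> for the training input number \<open>i\<close> and \<open>None\<close> for the
  test input.\<close>

definition gp_kernel ::
  "('d::finite, 'N::finite) gp \<Rightarrow> 'N option \<times> (real^'d) \<Rightarrow> 'N option \<times> (real^'d) \<Rightarrow> real" where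
  "gp_kernel g a b =
     (sigma_f g)\<^sup>2 *
       exp (- (1/2) * ((snd a - snd b) \<bullet> (matrix_inv (gp_Lambda g) *v (snd a - snd b))))
     + (sigma_eps g)\<^sup>2 * (if fst a = fst b then 1 else 0)"

definition gp_gram :: "('d::finite, 'N::finite) gp \<Rightarrow> ('N \<Rightarrow> real^'d) \<Rightarrow> real^'N^'N" where
  "gp_gram g D = (\<chi> i j. gp_kernel g (Some i, D i) (Some j, D j))"

definition gp_cross :: "('d::finite, 'N::finite) gp \<Rightarrow> ('N \<Rightarrow> real^'d) \<Rightarrow> real^'d \<Rightarrow> real^'N" where
  "gp_cross g D d = (\<chi> i. gp_kernel g (None, d) (Some i, D i))"

text \<open>The matrix \<open>K(D,D) + \<sigma>\<^sub>\<epsilon>\<^sup>2 I\<close>. Since the kernel has its own noise term, the noise variance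
  enters its diagonal twice.\<close>

definition gp_data_matrix :: "('d::finite, 'N::finite) gp \<Rightarrow> ('N \<Rightarrow> real^'d) \<Rightarrow> real^'N^'N" where
  "gp_data_matrix g D = gp_gram g D + mat ((sigma_eps g)\<^sup>2)"

definition post_mean :: "('d::finite, 'N::finite) gp \<Rightarrow> ('N \<Rightarrow> real^'d) \<Rightarrow> real^'d \<Rightarrow> real" where
  "post_mean g D d = gp_cross g D d \<bullet> (matrix_inv (gp_data_matrix g D) *v outputs g)"

definition post_var :: "('d::finite, 'N::finite) gp \<Rightarrow> ('N \<Rightarrow> real^'d) \<Rightarrow> real^'d \<Rightarrow> real" where
  "post_var g D d =
     gp_kernel g (None, d) (None, d)
     - gp_cross g D d \<bullet> (matrix_inv (gp_data_matrix g D) *v gp_cross g D d)"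

definition gp_admissible :: "('d::finite, 'N::finite) gp \<Rightarrow> ('N \<Rightarrow> real^'d) \<Rightarrow> bool" where
  "gp_admissible g D \<longleftrightarrow>
     sigma_f g \<ge> 0 \<and> sigma_eps g \<ge> 0 \<and>
     invertible (gp_Lambda g) \<and> invertible (gp_data_matrix g D)"

text \<open>A vector-valued function is modelled by a family of independent scalar processes, one for each
  component \<open>i :: 'k\<close>. The matrix \<open>S\<close> below stands for \<open>Q\<^sub>0\<close> or \<open>R\<^sub>0\<close>: \<open>inv_weight\<close> gives the inverses
  of \<open>Q\<^sub>d\<close>, \<open>R\<^sub>d\<close>, and \<open>inv_weight_min\<close> gives the matrices written as the inverses of
  \<open>Q\<^sub>m\<^sub>i\<^sub>n\<close>, \<open>R\<^sub>m\<^sub>i\<^sub>n\<close>.\<close>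

definition post_mean_vec ::
  "('k \<Rightarrow> ('d::finite, 'N::finite) gp) \<Rightarrow> ('N \<Rightarrow> real^'d) \<Rightarrow> real^'d \<Rightarrow> real^'k" where
  "post_mean_vec g D d = (\<chi> i. post_mean (g i) D d)"

definition inv_weight ::
  "('k \<Rightarrow> ('d::finite, 'N::finite) gp) \<Rightarrow> ('N \<Rightarrow> real^'d) \<Rightarrow> real^'k^'k \<Rightarrow> real^'d \<Rightarrow> real^'k^'k" where
  "inv_weight g D S d = matrix_inv (diag_matrix (\<chi> i. post_var (g i) D d) + S)"

definition inv_weight_min ::
  "('k \<Rightarrow> ('d::finite, 'N::finite) gp) \<Rightarrow> real^'k^'k \<Rightarrow> real^'k^'k" where
  "inv_weight_min g S =
     matrix_inv (diag_matrix (\<chi> i. (sigma_f (g i))\<^sup>2 + (sigma_eps (g i))\<^sup>2) + S)"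

definition inv_weight_max :: "real^'k^'k \<Rightarrow> real^'k^'k" where
  "inv_weight_max S = matrix_inv S"

text \<open>The supremum is a maximum when \<open>F\<close> is continuous on \<open>X \<times> U\<close> and \<open>X\<close>, \<open>U\<close> are compact and
  nonempty.\<close>

definition mismatch_max ::
  "(real^'n) set \<Rightarrow> (real^'m) set \<Rightarrow> (real^'n \<Rightarrow> real^'m \<Rightarrow> real^'k)
   \<Rightarrow> ('k \<Rightarrow> ('n + 'm, 'N::finite) gp) \<Rightarrow> ('N \<Rightarrow> real^('n + 'm)) \<Rightarrow> real^'k^'k \<Rightarrow> real" where
  "mismatch_max X U F g D S =
     (SUP (x, u) \<in> X \<times> U. wnorm (inv_weight_max S) (F x u - post_mean_vec g D (stack x u)))"

definition system_trajectory ::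
  "(real^'n \<Rightarrow> real^'m \<Rightarrow> real^'n) \<Rightarrow> (real^'n \<Rightarrow> real^'m \<Rightarrow> real^'p)
   \<Rightarrow> (real^'n) set \<Rightarrow> (real^'m) set
   \<Rightarrow> (nat \<Rightarrow> real^'n) \<Rightarrow> (nat \<Rightarrow> real^'m) \<Rightarrow> (nat \<Rightarrow> real^'n) \<Rightarrow> (nat \<Rightarrow> real^'p)
   \<Rightarrow> (nat \<Rightarrow> real^'p) \<Rightarrow> bool" where
  "system_trajectory f h X U x u w v y \<longleftrightarrow>
     (\<forall>t. x t \<in> X \<and> u t \<in> U \<and>
          x (Suc t) = f (x t) (u t) + w t \<and> y t = h (x t) (u t) + v t)"

text \<open>An estimator is a relation between the input sequence, the output sequence and the sequences
  of estimates that it may produce from them (the initial estimate being the first entry). It is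
  not a function because an estimate computed by optimization need not be unique. The maximum is
  taken over a finite nonempty set to which the disturbances contribute nothing at time \<open>0\<close>.\<close>

definition pRES ::
  "(real^'n \<Rightarrow> real^'m \<Rightarrow> real^'n) \<Rightarrow> (real^'n \<Rightarrow> real^'m \<Rightarrow> real^'p)
   \<Rightarrow> (real^'n) set \<Rightarrow> (real^'m) set
   \<Rightarrow> ((nat \<Rightarrow> real^'m) \<Rightarrow> (nat \<Rightarrow> real^'p) \<Rightarrow> (nat \<Rightarrow> real^'n) \<Rightarrow> bool) \<Rightarrow> bool" where
  "pRES f h X U est \<longleftrightarrow>
     (\<exists>C1 C2 C3 l1 l2 l3 \<alpha> :: real.
        C1 > 0 \<and> C2 > 0 \<and> C3 > 0 \<and>
        l1 \<in> {0..<1} \<and> l2 \<in> {0..<1} \<and> l3 \<in> {0..<1} \<and> \<alpha> > 0 \<and>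
        (\<forall>x u w v y xhat t.
           system_trajectory f h X U x u w v y \<longrightarrow> xhat 0 \<in> X \<longrightarrow> est u y xhat \<longrightarrow>
           norm (x t - xhat t) \<le>
             Max ({C1 * norm (x 0 - xhat 0) * l1 ^ t}
                  \<union> (\<lambda>j. C2 * norm (w j) * l2 ^ (t - j - 1)) ` {..<t}
                  \<union> (\<lambda>j. C3 * norm (v j) * l3 ^ (t - j - 1)) ` {..<t}
                  \<union> {\<alpha>})))"

text \<open>In the optimization problem at time \<open>t\<close>, the sequences \<open>xb\<close>, \<open>wb\<close>, \<open>vb\<close> are indexed by absolute
  time: \<open>xb j\<close> is the decision variable \<open>x(j|t)\<close>. Only the entries within the horizon matter.\<close>

definition mhe_feasible ::
  "('n \<Rightarrow> ('n + 'm, 'N::finite) gp) \<Rightarrow> ('p \<Rightarrow> ('n + 'm, 'N) gp) \<Rightarrow> ('N \<Rightarrow> real^('n + 'm))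
   \<Rightarrow> (real^'n) set \<Rightarrow> nat \<Rightarrow> (nat \<Rightarrow> real^'m) \<Rightarrow> (nat \<Rightarrow> real^'p) \<Rightarrow> nat
   \<Rightarrow> (nat \<Rightarrow> real^'n) \<Rightarrow> (nat \<Rightarrow> real^'n) \<Rightarrow> (nat \<Rightarrow> real^'p) \<Rightarrow> bool" where
  "mhe_feasible gx gy D X M u y t xb wb vb \<longleftrightarrow>
     (\<forall>j\<in>{t - min t M..<t}.
        xb (Suc j) = post_mean_vec gx D (stack (xb j) (u j)) + wb j \<and>
        y j = post_mean_vec gy D (stack (xb j) (u j)) + vb j) \<and>
     (\<forall>j\<in>{t - min t M..t}. xb j \<in> X)"

definition mhe_cost ::
  "('n \<Rightarrow> ('n + 'm, 'N::finite) gp) \<Rightarrow> ('p \<Rightarrow> ('n + 'm, 'N) gp) \<Rightarrow> ('N \<Rightarrow> real^('n + 'm))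
   \<Rightarrow> real \<Rightarrow> real^'n^'n \<Rightarrow> real^'n^'n \<Rightarrow> real^'p^'p \<Rightarrow> nat \<Rightarrow> (nat \<Rightarrow> real^'m) \<Rightarrow> real^'n \<Rightarrow> nat
   \<Rightarrow> (nat \<Rightarrow> real^'n) \<Rightarrow> (nat \<Rightarrow> real^'n) \<Rightarrow> (nat \<Rightarrow> real^'p) \<Rightarrow> real" where
  "mhe_cost gx gy D \<eta> P2 Q0 R0 M u xprior t xb wb vb =
     2 * \<eta> ^ min t M * (wnorm P2 (xb (t - min t M) - xprior))\<^sup>2
     + (\<Sum>j = 1..min t M. 2 * \<eta> ^ (j - 1) *
          ((wnorm (inv_weight gx D Q0 (stack (xb (t - j)) (u (t - j)))) (wb (t - j)))\<^sup>2
           + (wnorm (inv_weight gy D R0 (stack (xb (t - j)) (u (t - j)))) (vb (t - j)))\<^sup>2))"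

definition mhe_optimal ::
  "('n \<Rightarrow> ('n + 'm, 'N::finite) gp) \<Rightarrow> ('p \<Rightarrow> ('n + 'm, 'N) gp) \<Rightarrow> ('N \<Rightarrow> real^('n + 'm))
   \<Rightarrow> (real^'n) set \<Rightarrow> real \<Rightarrow> real^'n^'n \<Rightarrow> real^'n^'n \<Rightarrow> real^'p^'p \<Rightarrow> nat
   \<Rightarrow> (nat \<Rightarrow> real^'m) \<Rightarrow> (nat \<Rightarrow> real^'p) \<Rightarrow> real^'n \<Rightarrow> nat
   \<Rightarrow> (nat \<Rightarrow> real^'n) \<Rightarrow> (nat \<Rightarrow> real^'n) \<Rightarrow> (nat \<Rightarrow> real^'p) \<Rightarrow> bool" where
  "mhe_optimal gx gy D X \<eta> P2 Q0 R0 M u y xprior t xb wb vb \<longleftrightarrow>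
     mhe_feasible gx gy D X M u y t xb wb vb \<and>
     (\<forall>xb' wb' vb'. mhe_feasible gx gy D X M u y t xb' wb' vb' \<longrightarrow>
        mhe_cost gx gy D \<eta> P2 Q0 R0 M u xprior t xb wb vb
        \<le> mhe_cost gx gy D \<eta> P2 Q0 R0 M u xprior t xb' wb' vb')"

text \<open>At time \<open>0\<close> the horizon is empty and the condition is satisfied by the given initial estimate
  \<open>xhat 0 \<in> X\<close>.\<close>

definition gp_mhe ::
  "('n \<Rightarrow> ('n + 'm, 'N::finite) gp) \<Rightarrow> ('p \<Rightarrow> ('n + 'm, 'N) gp) \<Rightarrow> ('N \<Rightarrow> real^('n + 'm))
   \<Rightarrow> (real^'n) set \<Rightarrow> real \<Rightarrow> real^'n^'n \<Rightarrow> real^'n^'n \<Rightarrow> real^'p^'p \<Rightarrow> nat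
   \<Rightarrow> (nat \<Rightarrow> real^'m) \<Rightarrow> (nat \<Rightarrow> real^'p) \<Rightarrow> (nat \<Rightarrow> real^'n) \<Rightarrow> bool" where
  "gp_mhe gx gy D X \<eta> P2 Q0 R0 M u y xhat \<longleftrightarrow>
     (\<forall>t. \<exists>xb wb vb.
        mhe_optimal gx gy D X \<eta> P2 Q0 R0 M u y (xhat (t - min t M)) t xb wb vb \<and>
        xhat t = xb t)"

end

theory Submission
  imports Defs
begin

text \<open>The squared exponential kernel is positive semidefinite, so the posterior variances lie between
  \<open>0\<close> and \<open>\<sigma>\<^sub>f\<^sup>2 + \<sigma>\<^sub>\<epsilon>\<^sup>2\<close> and the inverse weights between their minimal and maximal versions. Write
  \<open>f\<close> and \<open>h\<close> as posterior means plus mismatch, and count the mismatch as part of the disturbances. Then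
  the true trajectory is feasible for the optimization problem. Iterating the dissipation inequality
  for \<open>W\<close> over a horizon of length \<open>M\<close> and comparing the optimal cost with the cost of the true
  trajectory gives, for the estimation error \<open>e\<close>,
  \<open>W(t) \<le> 4 \<eta>^M \<parallel>e(t-M)\<parallel>\<^sup>2 + 4 \<Sum> \<eta>^i (disturbances at t-1-i)\<^sup>2\<close> with the norm of \<open>P\<^sub>2\<close>. For large \<open>M\<close> the first
  term is at most \<open>\<mu>^M W(t-M)\<close> with \<open>\<mu> = (1 + \<eta>) / 2\<close>, so this can be iterated over successive horizons.
  Taking square roots leaves a sum over \<open>(\<surd>\<mu>)^i\<close>; one factor \<open>\<mu>^(i/4)\<close> goes into the maximum and the other
  is summed as a geometric series.\<close>

section \<open>Positive semidefiniteness of the Gaussian kernel\<close>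

text \<open>Induction on \<open>k\<close>: one factor \<open>p i \<bullet> p j\<close> is expanded
  in coordinates, and coordinate \<open>l\<close> is absorbed into the coefficients as
  \<open>c i * p i $ l\<close>. Hence the induction is over all \<open>c\<close>.\<close>

lemma sum_quadratic_power_inner_nonneg:
  fixes p :: "'i \<Rightarrow> real^'d"
  shows "(\<Sum>i\<in>I. \<Sum>j\<in>I. c i * c j * (p i \<bullet> p j) ^ k) \<ge> 0"
proof (induction k arbitrary: c)
  case 0
  have "(\<Sum>i\<in>I. \<Sum>j\<in>I. c i * c j * (p i \<bullet> p j) ^ 0) = (\<Sum>i\<in>I. c i)\<^sup>2"
    by (simp add: power2_eq_square sum_product)
  then show ?case by simp
next
  case (Suc k)
  have "(\<Sum>i\<in>I. \<Sum>j\<in>I. c i * c j * (p i \<bullet> p j) ^ Suc k)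
      = (\<Sum>i\<in>I. \<Sum>j\<in>I. \<Sum>l\<in>UNIV. (c i * p i $ l) * (c j * p j $ l) * (p i \<bullet> p j) ^ k)"
    by (intro sum.cong refl)
      (simp add: inner_vec_def sum_distrib_left sum_distrib_right mult_ac)
  also have "\<dots> = (\<Sum>i\<in>I. \<Sum>l\<in>UNIV. \<Sum>j\<in>I. (c i * p i $ l) * (c j * p j $ l) * (p i \<bullet> p j) ^ k)"
    by (intro sum.cong refl sum.swap)
  also have "\<dots> = (\<Sum>l\<in>UNIV. \<Sum>i\<in>I. \<Sum>j\<in>I. (c i * p i $ l) * (c j * p j $ l) * (p i \<bullet> p j) ^ k)"
    by (rule sum.swap)
  also have "\<dots> \<ge> 0"
    by (intro sum_nonneg Suc.IH)
  finally show ?case .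
qed

text \<open>The exponential series has nonnegative coefficients, so its quadratic form is a
  convergent series of the nonnegative forms of the powers.\<close>

lemma sum_quadratic_exp_inner_nonneg:
  fixes p :: "'i \<Rightarrow> real^'d"
  shows "(\<Sum>i\<in>I. \<Sum>j\<in>I. c i * c j * exp (p i \<bullet> p j)) \<ge> 0"
proof -
  have "(\<lambda>k. \<Sum>i\<in>I. \<Sum>j\<in>I. c i * c j * ((p i \<bullet> p j) ^ k /\<^sub>R fact k)) sums
      (\<Sum>i\<in>I. \<Sum>j\<in>I. c i * c j * exp (p i \<bullet> p j))"
    by (intro sums_sum sums_mult exp_converges)
  moreover have "(\<Sum>i\<in>I. \<Sum>j\<in>I. c i * c j * ((p i \<bullet> p j) ^ k /\<^sub>R fact k)) \<ge> 0" for k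
  proof -
    have "(\<Sum>i\<in>I. \<Sum>j\<in>I. c i * c j * ((p i \<bullet> p j) ^ k /\<^sub>R fact k))
        = (\<Sum>i\<in>I. \<Sum>j\<in>I. c i * c j * (p i \<bullet> p j) ^ k) / fact k"
      by (simp add: sum_distrib_left divide_inverse mult_ac)
    then show ?thesis
      by (simp add: sum_quadratic_power_inner_nonneg)
  qed
  ultimately show ?thesis
    by (rule sums_le[OF _ sums_zero, rotated])
qed

text \<open>Expanding the squared distance leaves \<open>exp (p i \<bullet> p j)\<close> times one
  factor in \<open>i\<close> and one in \<open>j\<close>; these two factors rescale the
  coefficients.\<close>

lemma sum_quadratic_gaussian_nonneg:
  fixes p :: "'i \<Rightarrow> real^'d"
  shows "(\<Sum>i\<in>I. \<Sum>j\<in>I. c i * c j * exp (- (1/2) * ((p i - p j) \<bullet> (p i - p j)))) \<ge> 0"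
proof -
  define b where "b i = c i * exp (- (p i \<bullet> p i) / 2)" for i
  have "c i * c j * exp (- (1/2) * ((p i - p j) \<bullet> (p i - p j)))
      = b i * b j * exp (p i \<bullet> p j)" for i j
  proof -
    have "exp (- (1/2) * ((p i - p j) \<bullet> (p i - p j)))
        = exp (- (p i \<bullet> p i) / 2) * exp (- (p j \<bullet> p j) / 2) * exp (p i \<bullet> p j)"
      by (simp add: algebra_simps inner_commute field_simps flip: exp_add)
    then show ?thesis
      by (simp add: b_def)
  qed
  then show ?thesis
    using sum_quadratic_exp_inner_nonneg[of b p I] by simp
qed

section \<open>Diagonal matrices and matrix inverses\<close>

lemma diag_matrix_mult_vec: "diag_matrix v *v x = (\<chi> i. v $ i * x $ i)"
  by (simp add: diag_matrix_def matrix_vector_mult_def vec_eq_iff if_distrib[of "\<lambda>z. z * _"]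
      cong: if_cong)

lemma invertible_diag_matrix_imp:
  assumes "invertible (diag_matrix v)"
  shows "v $ i \<noteq> 0"
proof
  assume "v $ i = 0"
  then have "diag_matrix v *v axis i 1 = 0"
    by (auto simp: diag_matrix_mult_vec vec_eq_iff axis_def)
  then have "axis i (1::real) = 0"
    using assms by (metis invertible_left_inverse matrix_left_invertible_ker)
  then show False
    by (simp add: axis_eq_0_iff)
qed

lemma matrix_inv_mult:
  assumes "invertible A"
  shows "A ** matrix_inv A = mat 1" "matrix_inv A ** A = mat 1"
  using someI_ex[OF assms[unfolded invertible_def]] by (simp_all add: matrix_inv_def)

lemma matrix_inv_mult_vec:
  fixes A :: "real^'k^'k"
  assumes "invertible A"
  shows "A *v (matrix_inv A *v x) = x" "matrix_inv A *v (A *v x) = x"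
  using assms by (simp_all add: matrix_vector_mul_assoc matrix_inv_mult)

lemma matrix_inv_diag_mult_vec:
  assumes "invertible (diag_matrix v)"
  shows "matrix_inv (diag_matrix v) *v x = (\<chi> i. x $ i / v $ i)"
proof -
  have "diag_matrix v *v (\<chi> i. x $ i / v $ i) = x"
    using invertible_diag_matrix_imp[OF assms] by (simp add: diag_matrix_mult_vec vec_eq_iff)
  then show ?thesis
    using matrix_inv_mult_vec(2)[OF assms] by metis
qed

section \<open>Bounds on the posterior variance\<close>

text \<open>Whitening: in these coordinates the quadratic form of the inverse of
  \<open>gp_Lambda g\<close> is the Euclidean one, so the kernel becomes the standard
  Gaussian.\<close>

definition gp_scale :: "('d::finite, 'N::finite) gp \<Rightarrow> real^'d \<Rightarrow> real^'d" where
  "gp_scale g x = (\<chi> k. x $ k / lengths g $ k)"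

lemma gp_kernel_eq:
  assumes "invertible (gp_Lambda g)"
  shows "gp_kernel g a b = (sigma_f g)\<^sup>2 * exp (- (1/2) *
      ((gp_scale g (snd a) - gp_scale g (snd b)) \<bullet> (gp_scale g (snd a) - gp_scale g (snd b))))
    + (sigma_eps g)\<^sup>2 * (if fst a = fst b then 1 else 0)"
  using assms unfolding gp_kernel_def gp_Lambda_def
  by (simp add: matrix_inv_diag_mult_vec inner_vec_def gp_scale_def power2_eq_square
      diff_divide_distrib[symmetric])

text \<open>This is the quadratic form of the kernel matrix of the test input and the training inputs at
  \<open>(s, z)\<close>, without the noise in the corner of the test input.\<close>

lemma gp_data_matrix_quadratic:
  fixes g :: "('d::finite, 'N::finite) gp"
  assumes "invertible (gp_Lambda g)"
  shows "0 \<le> (sigma_f g)\<^sup>2 * s\<^sup>2 + 2 * s * (z \<bullet> gp_cross g D d) + z \<bullet> (gp_data_matrix g D *v z)"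
proof -
  \<comment> \<open>The test input joins the training inputs as the point with index
    \<open>None\<close> and coefficient \<open>s\<close>.\<close>
  define p where "p o' = gp_scale g (case o' of None \<Rightarrow> d | Some i \<Rightarrow> D i)" for o'
  define c where "c o' = (case o' of None \<Rightarrow> s | Some i \<Rightarrow> z $ i)" for o'
  define E where "E a b = exp (- (1/2) * ((p a - p b) \<bullet> (p a - p b)))" for a b
  have UN: "(\<Sum>a\<in>UNIV. F a) = F None + (\<Sum>i\<in>UNIV. F (Some i))" for F :: "'N option \<Rightarrow> real"
    by (simp add: UNIV_option_conv sum.reindex)
  have sym: "E a b = E b a" for a b
    by (simp add: E_def inner_diff inner_commute algebra_simps)
  have cr: "gp_cross g D d $ i = (sigma_f g)\<^sup>2 * E None (Some i)" for i
    by (simp add: gp_cross_def gp_kernel_eq[OF assms] E_def p_def)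
  \<comment> \<open>The noise variance appears twice on the diagonal: once from the kernel and once
    from the matrix added in \<open>gp_data_matrix\<close>.\<close>
  have dm: "gp_data_matrix g D $ i $ j = (sigma_f g)\<^sup>2 * E (Some i) (Some j)
      + (if i = j then 2 * (sigma_eps g)\<^sup>2 else 0)" for i j
    by (simp add: gp_data_matrix_def gp_gram_def gp_kernel_eq[OF assms] E_def p_def mat_def)
  have q1: "z \<bullet> gp_cross g D d = (sigma_f g)\<^sup>2 * (\<Sum>i\<in>UNIV. z $ i * E None (Some i))"
    by (simp add: inner_vec_def cr sum_distrib_left mult_ac)
  have q2: "z \<bullet> (gp_data_matrix g D *v z) = (sigma_f g)\<^sup>2 *
      (\<Sum>i\<in>UNIV. \<Sum>j\<in>UNIV. z $ i * z $ j * E (Some i) (Some j)) + 2 * (sigma_eps g)\<^sup>2 * (z \<bullet> z)"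
  proof -
    have "z \<bullet> (gp_data_matrix g D *v z) = (\<Sum>i\<in>UNIV. z $ i *
        ((\<Sum>j\<in>UNIV. (sigma_f g)\<^sup>2 * E (Some i) (Some j) * z $ j) + 2 * (sigma_eps g)\<^sup>2 * z $ i))"
      by (simp add: inner_vec_def matrix_vector_mult_def dm distrib_right sum.distrib
          if_distrib[of "\<lambda>z. z * _"] cong: if_cong)
    then show ?thesis
      by (simp add: inner_vec_def distrib_left sum.distrib sum_distrib_left mult_ac)
  qed
  have "0 \<le> (\<Sum>a\<in>UNIV. \<Sum>b\<in>UNIV. c a * c b * E a b)"
    unfolding E_def by (rule sum_quadratic_gaussian_nonneg)
  also have "\<dots> = s\<^sup>2 * E None None + 2 * s * (\<Sum>i\<in>UNIV. z $ i * E None (Some i))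
      + (\<Sum>i\<in>UNIV. \<Sum>j\<in>UNIV. z $ i * z $ j * E (Some i) (Some j))"
    by (simp add: UN c_def sum.distrib sum_distrib_left mult_ac power2_eq_square sym[of "Some _" None])
  also have "E None None = 1"
    by (simp add: E_def)
  finally have "0 \<le> (sigma_f g)\<^sup>2 * (s\<^sup>2 * 1 + 2 * s * (\<Sum>i\<in>UNIV. z $ i * E None (Some i))
      + (\<Sum>i\<in>UNIV. \<Sum>j\<in>UNIV. z $ i * z $ j * E (Some i) (Some j)))"
    by simp
  moreover have "0 \<le> 2 * (sigma_eps g)\<^sup>2 * (z \<bullet> z)"
    by simp
  ultimately have "0 \<le> (sigma_f g)\<^sup>2 * (s\<^sup>2 * 1 + 2 * s * (\<Sum>i\<in>UNIV. z $ i * E None (Some i))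
      + (\<Sum>i\<in>UNIV. \<Sum>j\<in>UNIV. z $ i * z $ j * E (Some i) (Some j))) + 2 * (sigma_eps g)\<^sup>2 * (z \<bullet> z)"
    by (rule add_nonneg_nonneg)
  then show ?thesis
    unfolding q1 q2 by (simp add: algebra_simps)
qed

text \<open>A Schur complement argument: with \<open>b\<close> the inverse data matrix applied to
  the cross covariance, the quadratic form at \<open>(0, b)\<close> gives the upper bound and at
  \<open>(-1, b)\<close> the lower one.\<close>

lemma post_var_bounds:
  assumes "gp_admissible g D"
  shows "0 \<le> post_var g D d" "post_var g D d \<le> (sigma_f g)\<^sup>2 + (sigma_eps g)\<^sup>2"
proof -
  have L: "invertible (gp_Lambda g)" and I: "invertible (gp_data_matrix g D)"
    using assms by (auto simp: gp_admissible_def)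
  define b where "b = matrix_inv (gp_data_matrix g D) *v gp_cross g D d"
  have Bb: "gp_data_matrix g D *v b = gp_cross g D d"
    unfolding b_def by (rule matrix_inv_mult_vec(1)[OF I])
  have pv: "post_var g D d = (sigma_f g)\<^sup>2 + (sigma_eps g)\<^sup>2 - b \<bullet> gp_cross g D d"
    by (simp add: post_var_def gp_kernel_eq[OF L] b_def inner_commute)
  have "0 \<le> b \<bullet> gp_cross g D d"
    using gp_data_matrix_quadratic[OF L, of 0 b D d] by (simp add: Bb)
  then show "post_var g D d \<le> (sigma_f g)\<^sup>2 + (sigma_eps g)\<^sup>2"
    by (simp add: pv)
  have "b \<bullet> gp_cross g D d \<le> (sigma_f g)\<^sup>2"
    using gp_data_matrix_quadratic[OF L, of "-1" b D d] by (simp add: Bb)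
  then show "0 \<le> post_var g D d"
    by (simp add: pv add_increasing2)
qed

section \<open>Positive definite matrices and weighted norms\<close>

lemma sym_pos_def_imp_invertible:
  assumes "sym_pos_def P"
  shows "invertible P"
proof -
  have "x = 0" if "P *v x = 0" for x
    using assms that by (force simp: sym_pos_def_def)
  then show ?thesis
    by (simp add: invertible_left_inverse matrix_left_invertible_ker)
qed

lemma sym_pos_def_inner_nonneg: "sym_pos_def P \<Longrightarrow> 0 \<le> x \<bullet> (P *v x)"
  by (cases "x = 0") (auto simp: sym_pos_def_def intro: less_imp_le)

lemma sym_pos_def_inner_commute:
  assumes "sym_pos_def P"
  shows "x \<bullet> (P *v y) = y \<bullet> (P *v x)"
proof -
  have "x \<bullet> (P *v y) = (transpose P *v x) \<bullet> y"
    by (simp only: transpose_matrix_vector dot_lmul_matrix)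
  also have "transpose P = P"
    using assms by (simp add: sym_pos_def_def)
  finally show ?thesis
    by (simp only: inner_commute)
qed

text \<open>Positivity comes from rewriting the form of the inverse at \<open>x\<close> as the form
  of \<open>P\<close> at \<open>matrix_inv P *v x\<close>.\<close>

lemma sym_pos_def_matrix_inv:
  assumes "sym_pos_def P"
  shows "sym_pos_def (matrix_inv P)"
proof -
  note inv = sym_pos_def_imp_invertible[OF assms]
  note mi = matrix_inv_mult_vec[OF inv]
  have "transpose (matrix_inv P) = matrix_inv P"
    using assms matrix_inv_mult[OF inv]
    by (metis matrix_mul_assoc matrix_mul_lid matrix_mul_rid matrix_transpose_mul sym_pos_def_def
        transpose_mat)
  moreover have "0 < x \<bullet> (matrix_inv P *v x)" if "x \<noteq> 0" for x
  proof -
    have "matrix_inv P *v x \<noteq> 0"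
      using that mi(1)[of x] by auto
    then have "0 < (matrix_inv P *v x) \<bullet> (P *v (matrix_inv P *v x))"
      using assms by (auto simp: sym_pos_def_def)
    then show ?thesis
      by (simp add: mi inner_commute)
  qed
  ultimately show ?thesis
    by (simp add: sym_pos_def_def)
qed

lemma wnorm_nonneg: "sym_pos_def P \<Longrightarrow> 0 \<le> wnorm P x"
  by (simp add: wnorm_def sym_pos_def_inner_nonneg)

lemma wnorm_power2: "sym_pos_def P \<Longrightarrow> (wnorm P x)\<^sup>2 = x \<bullet> (P *v x)"
  by (simp add: wnorm_def sym_pos_def_inner_nonneg)

lemma wnorm_minus_commute: "wnorm P (x - y) = wnorm P (y - x)"
  using matrix_vector_mult_scaleR[of P "-1" "y - x"] by (simp add: wnorm_def inner_diff_left inner_diff_right)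

lemma wnorm_scaleR: "wnorm P (c *\<^sub>R x) = \<bar>c\<bar> * wnorm P x"
  by (simp add: wnorm_def matrix_vector_mult_scaleR real_sqrt_mult flip: mult.assoc power2_eq_square)

text \<open>As for any inner product, the inequality follows from Cauchy-Schwarz, here for the
  bilinear form of \<open>P\<close>.\<close>

lemma wnorm_triangle:
  assumes "sym_pos_def P"
  shows "wnorm P (x + y) \<le> wnorm P x + wnorm P y"
proof -
  let ?b = "\<lambda>x y. x \<bullet> (P *v y)"
  have comm: "?b y x = ?b x y"
    by (rule sym_pos_def_inner_commute[OF assms])
  have CS: "?b x y \<le> wnorm P x * wnorm P y"
  proof (cases "y = 0")
    case False
    then have pos: "0 < ?b y y"
      using assms by (simp add: sym_pos_def_def)
    \<comment> \<open>The vector is \<open>?b y y\<close> times the component of \<open>x\<close>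
      orthogonal to \<open>y\<close> with respect to the form; the scaling avoids a
      division.\<close>
    have "0 \<le> ?b (?b y y *\<^sub>R x - ?b x y *\<^sub>R y) (?b y y *\<^sub>R x - ?b x y *\<^sub>R y)"
      by (rule sym_pos_def_inner_nonneg[OF assms])
    also have "\<dots> = ?b y y * (?b y y * ?b x x - (?b x y)\<^sup>2)"
      by (simp add: matrix_vector_mult_diff_distrib matrix_vector_mult_scaleR inner_diff_left
          inner_diff_right comm algebra_simps power2_eq_square)
    finally have "(?b x y)\<^sup>2 \<le> ?b x x * ?b y y"
      using pos by (simp add: zero_le_mult_iff mult.commute)
    then have "(?b x y)\<^sup>2 \<le> (wnorm P x * wnorm P y)\<^sup>2"
      by (simp add: power_mult_distrib wnorm_power2[OF assms])
    then show ?thesis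
      by (rule power2_le_imp_le) (simp add: wnorm_nonneg[OF assms])
  qed (simp add: wnorm_def)
  have "(wnorm P (x + y))\<^sup>2 = (wnorm P x)\<^sup>2 + 2 * ?b x y + (wnorm P y)\<^sup>2"
    by (simp add: wnorm_power2[OF assms] matrix_vector_right_distrib inner_add_left
        inner_add_right comm)
  also have "\<dots> \<le> (wnorm P x + wnorm P y)\<^sup>2"
    using CS by (simp add: power2_sum)
  finally show ?thesis
    by (rule power2_le_imp_le) (simp add: wnorm_nonneg[OF assms])
qed

lemma wnorm_diff_power2_le:
  assumes "sym_pos_def P"
  shows "(wnorm P (x - y))\<^sup>2 \<le> 2 * (wnorm P x)\<^sup>2 + 2 * (wnorm P y)\<^sup>2"
proof -
  have "wnorm P (x - y) \<le> wnorm P x + wnorm P y"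
    using wnorm_triangle[OF assms, of x "- y"] wnorm_minus_commute[of P 0 y] by simp
  then have "(wnorm P (x - y))\<^sup>2 \<le> (wnorm P x + wnorm P y)\<^sup>2"
    by (simp add: power_mono wnorm_nonneg[OF assms])
  also have "\<dots> \<le> 2 * (wnorm P x)\<^sup>2 + 2 * (wnorm P y)\<^sup>2"
    using sum_squares_bound[of "wnorm P x" "wnorm P y"] by (simp add: power2_sum)
  finally show ?thesis .
qed

text \<open>The value \<open>x \<bullet> A\<^sup>-\<^sup>1 x\<close> is the maximum of \<open>2 x \<bullet> z - z \<bullet> A z\<close> over \<open>z\<close>; evaluate at \<open>z = B\<^sup>-\<^sup>1 x\<close>.\<close>

lemma wnorm_matrix_inv_antimono:
  assumes A: "sym_pos_def A" and B: "sym_pos_def B"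
    and le: "\<And>x. x \<bullet> (A *v x) \<le> x \<bullet> (B *v x)"
  shows "wnorm (matrix_inv B) x \<le> wnorm (matrix_inv A) x"
proof -
  define a b where "a = matrix_inv A *v x" and "b = matrix_inv B *v x"
  have Aa: "A *v a = x" and Bb: "B *v b = x"
    unfolding a_def b_def
    by (simp_all add: matrix_inv_mult_vec sym_pos_def_imp_invertible A B)
  have "0 \<le> (a - b) \<bullet> (A *v (a - b))"
    by (rule sym_pos_def_inner_nonneg[OF A])
  also have "\<dots> = a \<bullet> x - 2 * (b \<bullet> x) + b \<bullet> (A *v b)"
    using sym_pos_def_inner_commute[OF A, of a b]
    by (simp add: matrix_vector_mult_diff_distrib inner_diff_left inner_diff_right Aa)
  also have "\<dots> \<le> a \<bullet> x - b \<bullet> x"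
    using le[of b] by (simp add: Bb)
  finally show ?thesis
    by (simp add: wnorm_def a_def b_def inner_commute)
qed

lemma continuous_on_wnorm: "continuous_on S (wnorm P)"
  unfolding wnorm_def
  by (intro continuous_intros linear_continuous_on matrix_vector_mul_bounded_linear)

text \<open>Equivalence with the Euclidean norm: the extrema on the compact unit sphere give the
  constants, and homogeneity extends them to all vectors.\<close>

lemma wnorm_norm_bounds:
  fixes P :: "real^'k^'k"
  assumes "sym_pos_def P"
  obtains a b where "0 < a" "0 < b"
    "\<And>x. norm x \<le> a * wnorm P x" "\<And>x. wnorm P x \<le> b * norm x"
proof -
  let ?S = "sphere (0::real^'k) 1"
  have ne: "?S \<noteq> {}"
    by simp
  obtain p where p: "p \<in> ?S" "\<And>y. y \<in> ?S \<Longrightarrow> wnorm P p \<le> wnorm P y"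
    using continuous_attains_inf[OF compact_sphere ne continuous_on_wnorm] by metis
  obtain q where q: "q \<in> ?S" "\<And>y. y \<in> ?S \<Longrightarrow> wnorm P y \<le> wnorm P q"
    using continuous_attains_sup[OF compact_sphere ne continuous_on_wnorm] by metis
  have pos: "0 < wnorm P p"
    using p(1) assms by (cases "p = 0") (auto simp: wnorm_def sym_pos_def_def)
  have bounds: "norm x \<le> 1 / wnorm P p * wnorm P x \<and> wnorm P x \<le> wnorm P q * norm x" for x
  proof (cases "x = 0")
    case False
    define y where "y = (1 / norm x) *\<^sub>R x"
    have y: "y \<in> ?S" and x: "wnorm P x = norm x * wnorm P y"
      using False by (simp_all add: y_def wnorm_scaleR)
    have "norm x * wnorm P p \<le> wnorm P x" "wnorm P x \<le> norm x * wnorm P q"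
      unfolding x using p(2)[OF y] q(2)[OF y] by (simp_all add: mult_left_mono)
    then show ?thesis
      using pos by (simp add: field_simps)
  qed (simp add: wnorm_def)
  show thesis
  proof (rule that)
    show "0 < 1 / wnorm P p" "0 < wnorm P q"
      using pos q(2)[OF p(1)] by simp_all
    show "norm x \<le> 1 / wnorm P p * wnorm P x" "wnorm P x \<le> wnorm P q * norm x" for x
      using bounds[of x] by simp_all
  qed
qed

section \<open>Ordering of the weighting matrices\<close>

lemma sym_pos_def_diag_add:
  assumes "sym_pos_def S" "\<And>i. 0 \<le> v $ i"
  shows "sym_pos_def (diag_matrix v + S)"
proof -
  have "0 \<le> x \<bullet> (diag_matrix v *v x)" for x
    using assms(2) by (simp add: diag_matrix_mult_vec inner_vec_def sum_nonneg mult.left_commute)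
  then have "0 < x \<bullet> ((diag_matrix v + S) *v x)" if "x \<noteq> 0" for x
    using assms(1) that
    by (simp add: matrix_vector_mult_add_rdistrib inner_add_right sym_pos_def_def add_nonneg_pos)
  moreover have "transpose (diag_matrix v + S) = diag_matrix v + S"
    using assms(1) by (auto simp: sym_pos_def_def transpose_def diag_matrix_def vec_eq_iff)
  ultimately show ?thesis
    by (simp add: sym_pos_def_def)
qed

lemma wnorm_inv_diag_add_antimono:
  assumes "sym_pos_def S" "\<And>i. 0 \<le> v $ i" "\<And>i. v $ i \<le> v' $ i"
  shows "wnorm (matrix_inv (diag_matrix v' + S)) x \<le> wnorm (matrix_inv (diag_matrix v + S)) x"
proof (rule wnorm_matrix_inv_antimono)
  show "sym_pos_def (diag_matrix v + S)" "sym_pos_def (diag_matrix v' + S)"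
    using assms by (auto intro!: sym_pos_def_diag_add intro: order_trans)
  show "x \<bullet> ((diag_matrix v + S) *v x) \<le> x \<bullet> ((diag_matrix v' + S) *v x)" for x
  proof -
    have "x \<bullet> (diag_matrix v *v x) \<le> x \<bullet> (diag_matrix v' *v x)"
      using assms(3) unfolding diag_matrix_mult_vec inner_vec_def
      by (auto intro!: sum_mono simp: mult.left_commute mult_right_mono)
    then show ?thesis
      by (simp add: matrix_vector_mult_add_rdistrib inner_add_right)
  qed
qed

lemma sym_pos_def_inv_weight_min: "sym_pos_def S \<Longrightarrow> sym_pos_def (inv_weight_min g S)"
  unfolding inv_weight_min_def
  by (intro sym_pos_def_matrix_inv sym_pos_def_diag_add) auto

lemma
  fixes g :: "'k::finite \<Rightarrow> ('d::finite, 'N::finite) gp"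
  assumes "\<And>i. gp_admissible (g i) D" "sym_pos_def S"
  shows wnorm_inv_weight_min_le: "wnorm (inv_weight_min g S) x \<le> wnorm (inv_weight g D S d) x"
    and wnorm_inv_weight_le_max: "wnorm (inv_weight g D S d) x \<le> wnorm (inv_weight_max S) x"
proof -
  show "wnorm (inv_weight_min g S) x \<le> wnorm (inv_weight g D S d) x"
    unfolding inv_weight_min_def inv_weight_def
    by (rule wnorm_inv_diag_add_antimono) (simp_all add: assms post_var_bounds)
  \<comment> \<open>The maximal weight is the case of zero posterior variance.\<close>
  have "diag_matrix 0 + S = S"
    by (simp add: diag_matrix_def vec_eq_iff)
  then show "wnorm (inv_weight g D S d) x \<le> wnorm (inv_weight_max S) x"
    using wnorm_inv_diag_add_antimono[of S 0 "\<chi> i. post_var (g i) D d" x]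
    unfolding inv_weight_max_def inv_weight_def by (simp add: assms post_var_bounds)
qed

lemma sym_pos_def_inv_weight_max: "sym_pos_def S \<Longrightarrow> sym_pos_def (inv_weight_max S)"
  by (simp add: inv_weight_max_def sym_pos_def_matrix_inv)

section \<open>Continuity and the model mismatch\<close>

lemma continuous_on_post_mean_vec:
  fixes S :: "(real^'d) set"
  shows "continuous_on S (post_mean_vec g D)"
proof -
  have "continuous_on S (\<lambda>d. A *v (d - c))" for A :: "real^'d^'d" and c
    by (intro continuous_on_compose2[OF linear_continuous_on[OF matrix_vector_mul_bounded_linear]]
        continuous_intros) auto
  then have "continuous_on S (\<lambda>d. gp_kernel (g i) (None, d) (Some j, D j))" for i j
    unfolding gp_kernel_def by (intro continuous_intros) (simp_all add: continuous_intros)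
  then show ?thesis
    unfolding post_mean_vec_def post_mean_def gp_cross_def
    by (intro continuous_on_vec_lambda continuous_on_inner continuous_on_const)
qed

lemma continuous_on_stack: "continuous_on S (\<lambda>(x, u). stack x u)"
proof -
  have "continuous_on S (\<lambda>p. case k of Inl i \<Rightarrow> fst p $ i | Inr j \<Rightarrow> snd p $ j)" for k
    by (cases k) (auto intro!: continuous_intros)
  then show ?thesis
    unfolding stack_def split_beta by (rule continuous_on_vec_lambda)
qed

text \<open>A real \<open>SUP\<close> bounds its members only if they are bounded above; compactness
  of \<open>X \<times> U\<close> and continuity provide this.\<close>

lemma mismatch_max_upper:
  assumes "compact X" "compact U" "continuous_on (X \<times> U) (\<lambda>(x, u). F x u)" "x \<in> X" "u \<in> U"
  shows "wnorm (inv_weight_max S) (F x u - post_mean_vec g D (stack x u)) \<le> mismatch_max X U F g D S"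
proof -
  let ?G = "\<lambda>(x, u). wnorm (inv_weight_max S) (F x u - post_mean_vec g D (stack x u))"
  have "continuous_on (X \<times> U) ?G"
    using assms(3) unfolding split_beta
    by (intro continuous_on_compose2[OF continuous_on_wnorm[of UNIV]] continuous_on_diff
        continuous_on_compose2[OF continuous_on_post_mean_vec[of UNIV]]
        continuous_on_stack[unfolded split_beta]) auto
  then have "compact (?G ` (X \<times> U))"
    using assms(1,2) by (intro compact_continuous_image compact_Times)
  then have "bdd_above (?G ` (X \<times> U))"
    by (intro bounded_imp_bdd_above compact_imp_bounded)
  then have "?G (x, u) \<le> (SUP p\<in>X \<times> U. ?G p)"
    using assms(4,5) by (intro cSUP_upper) auto
  then show ?thesis
    by (simp add: mismatch_max_def)
qed

section \<open>Scalar recursions and discounted sums\<close>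

text \<open>The index \<open>i\<close> counts back from the final time, which matches the
  discounting in \<open>mhe_cost\<close>.\<close>

lemma geometric_recursion_bound:
  fixes V b :: "nat \<Rightarrow> real"
  assumes "0 \<le> \<eta>" "\<And>j. k \<le> j \<Longrightarrow> j < k + K \<Longrightarrow> V (Suc j) \<le> \<eta> * V j + b j"
  shows "V (k + K) \<le> \<eta> ^ K * V k + (\<Sum>i<K. \<eta> ^ i * b (k + K - Suc i))"
  using assms(2)
proof (induction K)
  case (Suc K)
  have "V (k + Suc K) \<le> \<eta> * V (k + K) + b (k + K)"
    using Suc.prems[of "k + K"] by simp
  also have "\<dots> \<le> \<eta> * (\<eta> ^ K * V k + (\<Sum>i<K. \<eta> ^ i * b (k + K - Suc i))) + b (k + K)"
    using Suc assms(1) by (intro add_right_mono mult_left_mono) auto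
  also have "\<dots> = \<eta> ^ Suc K * V k + (\<Sum>i<Suc K. \<eta> ^ i * b (k + Suc K - Suc i))"
    by (simp add: sum.lessThan_Suc_shift distrib_left sum_distrib_left mult_ac del: sum.lessThan_Suc)
  finally show ?case .
qed simp

text \<open>Strong induction in jumps of length \<open>M\<close>: the factor
  \<open>\<mu> ^ M\<close> shifts the sum of the earlier block so that it continues that of the last
  one. The remaining initial block, shorter than \<open>M\<close>, is covered by
  \<open>short\<close>.\<close>

lemma horizon_recursion_bound:
  fixes V b :: "nat \<Rightarrow> real"
  assumes "0 < M" "0 \<le> \<mu>"
    and short: "\<And>t. t < M \<Longrightarrow> V t \<le> \<mu> ^ t * E + (\<Sum>i<t. \<mu> ^ i * b (t - Suc i))"
    and long: "\<And>t. M \<le> t \<Longrightarrow> V t \<le> \<mu> ^ M * V (t - M) + (\<Sum>i<M. \<mu> ^ i * b (t - Suc i))"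
  shows "V t \<le> \<mu> ^ t * E + (\<Sum>i<t. \<mu> ^ i * b (t - Suc i))"
proof (induction t rule: less_induct)
  case (less t)
  show ?case
  proof (cases "t < M")
    case False
    define s where "s = t - M"
    have t: "t = M + s" and "s < t"
      using False assms(1) by (auto simp: s_def)
    have split: "(\<Sum>i<M + s. F i) = (\<Sum>i<M. F i) + (\<Sum>i<s. F (M + i))" for F :: "nat \<Rightarrow> real"
      by (induction s) (simp_all add: add.assoc)
    have "V t \<le> \<mu> ^ M * V s + (\<Sum>i<M. \<mu> ^ i * b (t - Suc i))"
      using long[of t] False by (simp add: s_def)
    also have "\<dots> \<le> \<mu> ^ M * (\<mu> ^ s * E + (\<Sum>i<s. \<mu> ^ i * b (s - Suc i)))
        + (\<Sum>i<M. \<mu> ^ i * b (t - Suc i))"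
      using less[OF \<open>s < t\<close>] assms(2) by (intro add_right_mono mult_left_mono) auto
    also have "\<dots> = \<mu> ^ t * E + (\<Sum>i<t. \<mu> ^ i * b (t - Suc i))"
      unfolding t split by (simp add: power_add distrib_left sum_distrib_left mult_ac)
    finally show ?thesis .
  qed (rule short)
qed

text \<open>Let \<open>m\<close> be the maximum. The term \<open>2 * E\<close> is at most
  \<open>m / 3\<close>. In the sum, \<open>(r\<^sup>2) ^ i\<close> splits into two factors
  \<open>r ^ i\<close>: the first brings each of the four parts \<open>a i\<close>,
  \<open>b i\<close>, \<open>c\<close>, \<open>c\<close> below \<open>m * (1 - r) / 12\<close>, the
  second is summed geometrically. This contributes at most \<open>2 / 3 * m\<close>.\<close>

lemma discounted_sum_le_Max:
  fixes r E c z :: real and a b :: "nat \<Rightarrow> real"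
  assumes r: "0 \<le> r" "r < 1" and "0 \<le> c" "\<And>i. 0 \<le> a i" "\<And>i. 0 \<le> b i"
    and z: "z \<le> 2 * E + (\<Sum>i<t. (r\<^sup>2) ^ i * (2 * (a i + b i + 2 * c)))"
  shows "z \<le> Max ({6 * E} \<union> (\<lambda>q. 12 / (1 - r) * r ^ q * a q) ` {..<t}
      \<union> (\<lambda>q. 12 / (1 - r) * r ^ q * b q) ` {..<t} \<union> {12 / (1 - r) * c})"
    (is "_ \<le> Max ?S")
proof -
  have le: "s \<le> Max ?S" if "s \<in> ?S" for s
    using that by (intro Max_ge) auto
  define m where "m = Max ?S"
  have a: "12 / (1 - r) * r ^ q * a q \<le> m" and b: "12 / (1 - r) * r ^ q * b q \<le> m"
    if "q < t" for q
    unfolding m_def using that by (intro le, blast)+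
  have c: "12 / (1 - r) * c \<le> m" and E: "6 * E \<le> m"
    unfolding m_def by (intro le, blast)+
  \<comment> \<open>Nonnegativity of \<open>m\<close> is what allows the factor
    \<open>1 - r ^ t\<close> to be dropped at the end.\<close>
  have "0 \<le> 12 / (1 - r) * c"
    using assms by simp
  then have m: "0 \<le> m"
    using c by linarith
  have summand: "(r\<^sup>2) ^ i * (2 * (a i + b i + 2 * c)) \<le> 2 / 3 * m * ((1 - r) * r ^ i)"
    if "i < t" for i
  proof -
    have ri: "0 \<le> r ^ i" "r ^ i \<le> 1"
      using r by (simp_all add: power_le_one)
    have "r ^ i * a i \<le> m * (1 - r) / 12" "r ^ i * b i \<le> m * (1 - r) / 12"
      using a[OF that] b[OF that] r by (simp_all add: field_simps)
    moreover have "r ^ i * c \<le> c"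
      using ri \<open>0 \<le> c\<close> by (simp add: mult_left_le_one_le)
    moreover have "c \<le> m * (1 - r) / 12"
      using c r by (simp add: field_simps)
    ultimately have "2 * (r ^ i * a i + r ^ i * b i + 2 * (r ^ i * c)) \<le> 2 / 3 * (m * (1 - r))"
      by simp
    from mult_left_mono[OF this ri(1)] show ?thesis
      by (simp add: power_mult[symmetric] mult.commute[of 2 i] power_mult power2_eq_square
          algebra_simps)
  qed
  have "(\<Sum>i<t. (r\<^sup>2) ^ i * (2 * (a i + b i + 2 * c))) \<le> (\<Sum>i<t. 2 / 3 * m * ((1 - r) * r ^ i))"
    using summand by (intro sum_mono) auto
  also have "\<dots> = 2 / 3 * m * (1 - r ^ t)"
    by (simp add: one_diff_power_eq sum_distrib_left)
  also have "\<dots> \<le> 2 / 3 * m"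
    using r m by (simp add: mult_left_le)
  finally show ?thesis
    using z E by (simp add: m_def)
qed

section \<open>Estimation error of the moving horizon estimator\<close>

text \<open>Only the learned model is fixed here. The true \<open>f\<close> and \<open>h\<close>
  enter later, as posterior means plus mismatch, so the error bounds can first be proved for
  trajectories of the learned model.\<close>

locale detectable_gp_model =
  fixes X :: "(real^'n) set" and U :: "(real^'m) set"
    and D :: "'N::finite \<Rightarrow> real^('n + 'm)"
    and gx :: "'n \<Rightarrow> ('n + 'm, 'N) gp" and gy :: "'p::finite \<Rightarrow> ('n + 'm, 'N) gp"
    and W :: "real^'n \<Rightarrow> real^'n \<Rightarrow> real" and \<eta> :: real
    and P1 P2 Q0 :: "real^'n^'n" and R0 :: "real^'p^'p"
  assumes gp_x: "\<And>i. gp_admissible (gx i) D" and gp_y: "\<And>j. gp_admissible (gy j) D"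
    and eta: "\<eta> \<in> {0..<1}"
    and P1: "sym_pos_def P1" and P2: "sym_pos_def P2"
    and Q0: "sym_pos_def Q0" and R0: "sym_pos_def R0"
    and W_bounds: "\<And>x x'. x \<in> X \<Longrightarrow> x' \<in> X \<Longrightarrow>
           (wnorm P1 (x - x'))\<^sup>2 \<le> W x x' \<and> W x x' \<le> (wnorm P2 (x - x'))\<^sup>2"
    and W_decrease: "\<And>x x' u w w'. x \<in> X \<Longrightarrow> x' \<in> X \<Longrightarrow> u \<in> U \<Longrightarrow>
           W (post_mean_vec gx D (stack x u) + w) (post_mean_vec gx D (stack x' u) + w')
           \<le> \<eta> * W x x'
             + (wnorm (inv_weight_min gx Q0) (w - w'))\<^sup>2
             + (wnorm (inv_weight_min gy R0)
                  (post_mean_vec gy D (stack x u) - post_mean_vec gy D (stack x' u)))\<^sup>2"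
begin

text \<open>Applying \<open>W_decrease\<close> along the pair of optimal and true trajectory bounds
  \<open>W\<close> by the optimal cost plus a contribution of the true data. The optimal cost is at
  most that of the true trajectory; both contributions carry a factor \<open>2\<close>, hence the
  \<open>4\<close>.\<close>

lemma mhe_horizon_bound:
  assumes opt: "mhe_optimal gx gy D X \<eta> P2 Q0 R0 M u y xprior t xb wb vb"
    and inX: "\<And>j. x j \<in> X" and inU: "\<And>j. u j \<in> U"
    and x: "\<And>j. x (Suc j) = post_mean_vec gx D (stack (x j) (u j)) + w j"
    and y: "\<And>j. y j = post_mean_vec gy D (stack (x j) (u j)) + v j"
  shows "W (xb t) (x t) \<le> \<eta> ^ min t M * (4 * (wnorm P2 (xprior - x (t - min t M)))\<^sup>2)
    + (\<Sum>i<min t M. \<eta> ^ i * (4 * ((wnorm (inv_weight_max Q0) (w (t - Suc i)))\<^sup>2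
        + (wnorm (inv_weight_max R0) (v (t - Suc i)))\<^sup>2)))"
proof -
  define K where "K = min t M"
  define k where "k = t - K"
  have t: "t = k + K"
    by (simp add: k_def K_def)
  have eta0: "0 \<le> \<eta>"
    using eta by simp
  note Qmin = sym_pos_def_inv_weight_min[OF Q0, of gx]
    and Rmin = sym_pos_def_inv_weight_min[OF R0, of gy]
  \<comment> \<open>Stage costs: \<open>Jb\<close> of the optimal trajectory, \<open>Jx\<close> of
    the true one, each weighted at its own inputs. \<open>Jm\<close> and \<open>Jn\<close> replace
    the weights in \<open>Jx\<close> by the uniform maximal and minimal ones.\<close>
  define Jb where "Jb j = (wnorm (inv_weight gx D Q0 (stack (xb j) (u j))) (wb j))\<^sup>2
    + (wnorm (inv_weight gy D R0 (stack (xb j) (u j))) (vb j))\<^sup>2" for j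
  define Jx where "Jx j = (wnorm (inv_weight gx D Q0 (stack (x j) (u j))) (w j))\<^sup>2
    + (wnorm (inv_weight gy D R0 (stack (x j) (u j))) (v j))\<^sup>2" for j
  define Jm where "Jm j = (wnorm (inv_weight_max Q0) (w j))\<^sup>2
    + (wnorm (inv_weight_max R0) (v j))\<^sup>2" for j
  define Jn where "Jn j = (wnorm (inv_weight_min gx Q0) (w j))\<^sup>2
    + (wnorm (inv_weight_min gy R0) (v j))\<^sup>2" for j
  have wn: "0 \<le> wnorm (inv_weight_min gx Q0) z" "0 \<le> wnorm (inv_weight_min gy R0) z'" for z z'
    by (simp_all add: wnorm_nonneg Qmin Rmin)
  have wd: "0 \<le> wnorm (inv_weight gx D Q0 d) z" "0 \<le> wnorm (inv_weight gy D R0 d) z'" for d z z'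
    by (rule order_trans[OF wn(1) wnorm_inv_weight_min_le[OF gp_x Q0]],
        rule order_trans[OF wn(2) wnorm_inv_weight_min_le[OF gp_y R0]])
  have Jxm: "Jx j \<le> Jm j" for j
    unfolding Jx_def Jm_def
    by (intro add_mono power_mono wnorm_inv_weight_le_max gp_x gp_y Q0 R0 wd)
  have Jnx: "Jn j \<le> Jx j" for j
    unfolding Jx_def Jn_def
    by (intro add_mono power_mono wnorm_inv_weight_min_le gp_x gp_y Q0 R0 wn)
  have xbX: "xb j \<in> X" if "k \<le> j" "j \<le> t" for j
    using opt that by (auto simp: mhe_optimal_def mhe_feasible_def k_def K_def)
  have step: "W (xb (Suc j)) (x (Suc j)) \<le> \<eta> * W (xb j) (x j) + (2 * Jb j + 2 * Jm j)"
    if j: "k \<le> j" "j < k + K" for j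
  proof -
    have xb: "xb (Suc j) = post_mean_vec gx D (stack (xb j) (u j)) + wb j"
      and yb: "y j = post_mean_vec gy D (stack (xb j) (u j)) + vb j"
      using opt j by (auto simp: mhe_optimal_def mhe_feasible_def k_def K_def)
    \<comment> \<open>Both trajectories explain the same measurement, so the predicted outputs
      differ exactly by the output disturbances.\<close>
    have dy: "post_mean_vec gy D (stack (xb j) (u j)) - post_mean_vec gy D (stack (x j) (u j))
        = v j - vb j"
      using y[of j] yb by (simp add: algebra_simps)
    have "W (xb (Suc j)) (x (Suc j)) \<le> \<eta> * W (xb j) (x j)
        + (wnorm (inv_weight_min gx Q0) (wb j - w j))\<^sup>2 + (wnorm (inv_weight_min gy R0) (v j - vb j))\<^sup>2"
      using W_decrease[of "xb j" "x j" "u j" "wb j" "w j"] xbX[of j] inX[of j] inU[of j] j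
      by (simp add: xb[symmetric] x[symmetric] dy t)
    also have "\<dots> \<le> \<eta> * W (xb j) (x j) + (2 * ((wnorm (inv_weight_min gx Q0) (wb j))\<^sup>2
        + (wnorm (inv_weight_min gy R0) (vb j))\<^sup>2) + 2 * Jn j)"
      using wnorm_diff_power2_le[OF Qmin, of "wb j" "w j"] wnorm_diff_power2_le[OF Rmin, of "v j" "vb j"]
      by (simp add: Jn_def)
    \<comment> \<open>The minimal weights do not depend on the input, so they can be raised
      separately: to the weights along \<open>xb\<close> in the first part and to the maximal ones
      in \<open>Jn\<close>.\<close>
    also have "\<dots> \<le> \<eta> * W (xb j) (x j) + (2 * Jb j + 2 * Jm j)"
      unfolding Jb_def
      by (intro add_left_mono add_mono mult_left_mono power_mono wnorm_inv_weight_min_le gp_x gp_y Q0 R0 wn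
          order_trans[OF Jnx Jxm]) auto
    finally show ?thesis .
  qed
  have iter: "W (xb t) (x t) \<le> \<eta> ^ K * W (xb k) (x k)
      + (\<Sum>i<K. \<eta> ^ i * (2 * Jb (t - Suc i) + 2 * Jm (t - Suc i)))"
    using geometric_recursion_bound[OF eta0, of k K "\<lambda>j. W (xb j) (x j)", OF step]
    by (simp add: t)
  \<comment> \<open>The true trajectory is a candidate because its states lie in
    \<open>X\<close>.\<close>
  have "mhe_feasible gx gy D X M u y t x w v"
    using inX x y by (simp add: mhe_feasible_def)
  then have "mhe_cost gx gy D \<eta> P2 Q0 R0 M u xprior t xb wb vb
      \<le> mhe_cost gx gy D \<eta> P2 Q0 R0 M u xprior t x w v"
    using opt by (auto simp: mhe_optimal_def)
  then have "2 * \<eta> ^ K * (wnorm P2 (xb k - xprior))\<^sup>2 + (\<Sum>i<K. 2 * \<eta> ^ i * Jb (t - Suc i))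
      \<le> 2 * \<eta> ^ K * (wnorm P2 (x k - xprior))\<^sup>2 + (\<Sum>i<K. 2 * \<eta> ^ i * Jx (t - Suc i))"
    by (simp add: mhe_cost_def K_def[symmetric] k_def[symmetric] sum.atLeast1_atMost_eq
        Jb_def Jx_def)
  also have "\<dots> \<le> 2 * \<eta> ^ K * (wnorm P2 (xprior - x k))\<^sup>2 + (\<Sum>i<K. 2 * \<eta> ^ i * Jm (t - Suc i))"
    unfolding wnorm_minus_commute[of P2 "x k"] using eta0
    by (intro add_left_mono sum_mono mult_left_mono Jxm) auto
  finally have cost: "2 * \<eta> ^ K * (wnorm P2 (xb k - xprior))\<^sup>2 + (\<Sum>i<K. 2 * \<eta> ^ i * Jb (t - Suc i))
      \<le> 2 * \<eta> ^ K * (wnorm P2 (xprior - x k))\<^sup>2 + (\<Sum>i<K. 2 * \<eta> ^ i * Jm (t - Suc i))" .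
  \<comment> \<open>Inserting the prior splits the error at the start of the horizon into the
    arrival cost of the optimizer and the error of the prior.\<close>
  have "W (xb k) (x k) \<le> (wnorm P2 ((xb k - xprior) - (x k - xprior)))\<^sup>2"
    using W_bounds[OF xbX inX, of k k] by (simp add: t)
  also have "\<dots> \<le> 2 * (wnorm P2 (xb k - xprior))\<^sup>2 + 2 * (wnorm P2 (xprior - x k))\<^sup>2"
    using wnorm_diff_power2_le[OF P2, of "xb k - xprior" "x k - xprior"]
    by (simp add: wnorm_minus_commute[of P2 "x k"])
  finally have "\<eta> ^ K * W (xb k) (x k)
      \<le> \<eta> ^ K * (2 * (wnorm P2 (xb k - xprior))\<^sup>2 + 2 * (wnorm P2 (xprior - x k))\<^sup>2)"
    using eta0 by (simp add: mult_left_mono)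
  moreover have "(\<Sum>i<K. \<eta> ^ i * (4 * Jm (t - Suc i))) = 4 * (\<Sum>i<K. \<eta> ^ i * Jm (t - Suc i))"
    by (simp add: sum_distrib_left mult.left_commute)
  ultimately have "W (xb t) (x t) \<le> \<eta> ^ K * (4 * (wnorm P2 (xprior - x k))\<^sup>2)
      + (\<Sum>i<K. \<eta> ^ i * (4 * Jm (t - Suc i)))"
    using iter cost
    by (simp add: distrib_left sum.distrib sum_distrib_left[symmetric] mult.assoc mult.left_commute)
  then show ?thesis
    by (simp add: K_def k_def Jm_def)
qed

lemma gp_mhe_in_X:
  assumes "gp_mhe gx gy D X \<eta> P2 Q0 R0 M u y xhat"
  shows "xhat t \<in> X"
proof -
  obtain xb wb vb where "mhe_optimal gx gy D X \<eta> P2 Q0 R0 M u y (xhat (t - min t M)) t xb wb vb"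
    and "xhat t = xb t"
    using assms unfolding gp_mhe_def by blast
  then show ?thesis
    by (simp add: mhe_optimal_def mhe_feasible_def)
qed

text \<open>The hypothesis \<open>contr\<close> absorbs the factor \<open>4\<close> and the change
  from \<open>P2\<close> to \<open>P1\<close>, at the price of the slower rate \<open>\<mu>\<close>;
  since \<open>W\<close> dominates the \<open>P1\<close> norm, successive horizons can be chained.
  Only the initial error keeps the \<open>P2\<close> norm.\<close>

lemma gp_mhe_error_bound:
  assumes mhe: "gp_mhe gx gy D X \<eta> P2 Q0 R0 M u y xhat" and M: "0 < M"
    and mu: "\<eta> \<le> \<mu>"
    and contr: "\<And>z. 4 * \<eta> ^ M * (wnorm P2 z)\<^sup>2 \<le> \<mu> ^ M * (wnorm P1 z)\<^sup>2"
    and inX: "\<And>j. x j \<in> X" and inU: "\<And>j. u j \<in> U"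
    and x: "\<And>j. x (Suc j) = post_mean_vec gx D (stack (x j) (u j)) + w j"
    and y: "\<And>j. y j = post_mean_vec gy D (stack (x j) (u j)) + v j"
  shows "wnorm P1 (xhat t - x t) \<le> 2 * sqrt \<mu> ^ t * wnorm P2 (xhat 0 - x 0)
    + (\<Sum>i<t. sqrt \<mu> ^ i * (2 * (wnorm (inv_weight_max Q0) (w (t - Suc i))
        + wnorm (inv_weight_max R0) (v (t - Suc i)))))"
proof -
  have eta0: "0 \<le> \<eta>" and mu0: "0 \<le> \<mu>"
    using eta mu by auto
  note hatX = gp_mhe_in_X[OF mhe]
  define a where "a j = wnorm (inv_weight_max Q0) (w j)" for j
  define b where "b j = wnorm (inv_weight_max R0) (v j)" for j
  have ab: "0 \<le> a j" "0 \<le> b j" for j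
    by (simp_all add: a_def b_def wnorm_nonneg sym_pos_def_inv_weight_max Q0 R0)
  define e where "e j = 4 * ((a j)\<^sup>2 + (b j)\<^sup>2)" for j
  define E where "E = wnorm P2 (xhat 0 - x 0)"
  have E: "0 \<le> E"
    by (simp add: E_def wnorm_nonneg P2)
  have bound: "W (xhat t) (x t) \<le> \<eta> ^ min t M * (4 * (wnorm P2 (xhat (t - min t M) - x (t - min t M)))\<^sup>2)
    + (\<Sum>i<min t M. \<eta> ^ i * e (t - Suc i))" for t
  proof -
    obtain xb wb vb
      where "mhe_optimal gx gy D X \<eta> P2 Q0 R0 M u y (xhat (t - min t M)) t xb wb vb"
      and "xhat t = xb t"
      using mhe unfolding gp_mhe_def by blast
    from mhe_horizon_bound[OF this(1) inX inU x y] this(2) show ?thesis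
      by (simp add: e_def a_def b_def)
  qed
  have sums: "(\<Sum>i<K. \<eta> ^ i * e (t - Suc i)) \<le> (\<Sum>i<K. \<mu> ^ i * e (t - Suc i))" for K t
    using eta0 mu by (intro sum_mono mult_right_mono power_mono) (auto simp: e_def)
  have "W (xhat t) (x t) \<le> \<mu> ^ t * (4 * E\<^sup>2) + (\<Sum>i<t. \<mu> ^ i * e (t - Suc i))" for t
  proof (rule horizon_recursion_bound[OF M mu0])
    fix t assume "t < M"
    then have "W (xhat t) (x t) \<le> \<eta> ^ t * (4 * E\<^sup>2) + (\<Sum>i<t. \<eta> ^ i * e (t - Suc i))"
      using bound[of t] by (simp add: E_def)
    also have "\<dots> \<le> \<mu> ^ t * (4 * E\<^sup>2) + (\<Sum>i<t. \<mu> ^ i * e (t - Suc i))"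
      using eta0 mu by (intro add_mono sums mult_right_mono power_mono) auto
    finally show "W (xhat t) (x t) \<le> \<mu> ^ t * (4 * E\<^sup>2) + (\<Sum>i<t. \<mu> ^ i * e (t - Suc i))" .
  next
    fix t assume "M \<le> t"
    then have "W (xhat t) (x t) \<le> 4 * \<eta> ^ M * (wnorm P2 (xhat (t - M) - x (t - M)))\<^sup>2
        + (\<Sum>i<M. \<eta> ^ i * e (t - Suc i))"
      using bound[of t] by (simp add: min_absorb2 mult_ac)
    also have "\<dots> \<le> \<mu> ^ M * W (xhat (t - M)) (x (t - M)) + (\<Sum>i<M. \<mu> ^ i * e (t - Suc i))"
      using contr[of "xhat (t - M) - x (t - M)"] W_bounds[OF hatX inX, of "t - M" "t - M"] mu0
      by (intro add_mono sums order_trans[OF contr] mult_left_mono) auto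
    finally show "W (xhat t) (x t)
        \<le> \<mu> ^ M * W (xhat (t - M)) (x (t - M)) + (\<Sum>i<M. \<mu> ^ i * e (t - Suc i))" .
  qed
  then have "(wnorm P1 (xhat t - x t))\<^sup>2 \<le> \<mu> ^ t * (4 * E\<^sup>2) + (\<Sum>i<t. \<mu> ^ i * e (t - Suc i))"
    using W_bounds[OF hatX inX, of t t] order_trans by blast
  also have "\<dots> \<le> \<mu> ^ t * (4 * E\<^sup>2) + (\<Sum>i<t. \<mu> ^ i * (2 * (a (t - Suc i) + b (t - Suc i)))\<^sup>2)"
    using mu0 ab by (intro add_left_mono sum_mono mult_left_mono) (auto simp: e_def power2_sum)
  also have "\<dots> = (2 * sqrt \<mu> ^ t * E)\<^sup>2
      + (\<Sum>i<t. (sqrt \<mu> ^ i * (2 * (a (t - Suc i) + b (t - Suc i))))\<^sup>2)"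
    using mu0 by (simp add: power_mult_distrib flip: real_sqrt_power)
  finally have "wnorm P1 (xhat t - x t) \<le> sqrt ((2 * sqrt \<mu> ^ t * E)\<^sup>2
      + (\<Sum>i<t. (sqrt \<mu> ^ i * (2 * (a (t - Suc i) + b (t - Suc i))))\<^sup>2))"
    by (rule real_le_rsqrt)
  \<comment> \<open>The square root is subadditive, and the Euclidean norm of the sequence is at
    most its sum.\<close>
  also have "\<dots> \<le> sqrt ((2 * sqrt \<mu> ^ t * E)\<^sup>2)
      + L2_set (\<lambda>i. sqrt \<mu> ^ i * (2 * (a (t - Suc i) + b (t - Suc i)))) {..<t}"
    unfolding L2_set_def by (intro sqrt_add_le_add_sqrt) (auto intro: sum_nonneg)
  also have "\<dots> \<le> 2 * sqrt \<mu> ^ t * E + (\<Sum>i<t. sqrt \<mu> ^ i * (2 * (a (t - Suc i) + b (t - Suc i))))"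
    using mu0 ab E by (intro add_mono L2_set_le_sum) auto
  finally show ?thesis
    by (simp add: a_def b_def E_def)
qed

text \<open>By norm equivalence it suffices that
  \<open>4 * (b * a)\<^sup>2 * (\<eta> / \<mu>) ^ M\<close> is at most \<open>1\<close>, which holds
  for large \<open>M\<close> as soon as \<open>\<eta> < \<mu>\<close>.\<close>

lemma contraction_rate:
  obtains \<mu> M0 where "\<eta> \<le> \<mu>" "0 < \<mu>" "\<mu> < 1" "0 < M0"
    "\<And>M z. M0 \<le> M \<Longrightarrow> 4 * \<eta> ^ M * (wnorm P2 z)\<^sup>2 \<le> \<mu> ^ M * (wnorm P1 z)\<^sup>2"
proof -
  obtain a a' where a: "0 < a" "0 < a'" "\<And>z. norm z \<le> a * wnorm P1 z"
    "\<And>z. wnorm P1 z \<le> a' * norm z"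
    by (rule wnorm_norm_bounds[OF P1], rule that)
  obtain b' b where b: "0 < b'" "0 < b" "\<And>z. norm z \<le> b' * wnorm P2 z"
    "\<And>z. wnorm P2 z \<le> b * norm z"
    by (rule wnorm_norm_bounds[OF P2], rule that)
  have cmp: "(wnorm P2 z)\<^sup>2 \<le> (b * a)\<^sup>2 * (wnorm P1 z)\<^sup>2" for z
  proof -
    have "wnorm P2 z \<le> b * (a * wnorm P1 z)"
      using a b by (meson order_trans mult_left_mono less_imp_le)
    from power_mono[OF this wnorm_nonneg[OF P2], of 2] show ?thesis
      by (simp add: power_mult_distrib mult_ac)
  qed
  \<comment> \<open>The midpoint of \<open>\<eta>\<close> and \<open>1\<close> is positive even for
    \<open>\<eta> = 0\<close>, so the quotient \<open>\<eta> / \<mu>\<close> is meaningful.\<close>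
  define \<mu> where "\<mu> = (1 + \<eta>) / 2"
  have mu: "\<eta> < \<mu>" "0 < \<mu>" "\<mu> < 1"
    using eta by (auto simp: \<mu>_def)
  have "(\<lambda>M. 4 * (b * a)\<^sup>2 * (\<eta> / \<mu>) ^ M) \<longlonglongrightarrow> 4 * (b * a)\<^sup>2 * 0"
    using mu eta by (intro tendsto_mult tendsto_const LIMSEQ_power_zero) simp
  then have "eventually (\<lambda>M. 4 * (b * a)\<^sup>2 * (\<eta> / \<mu>) ^ M < 1) sequentially"
    by (rule order_tendstoD) simp
  then obtain M0 where M0: "\<And>M. M0 \<le> M \<Longrightarrow> 4 * (b * a)\<^sup>2 * (\<eta> / \<mu>) ^ M < 1"
    by (auto simp: eventually_sequentially)
  \<comment> \<open>The successor ensures a positive horizon length.\<close>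
  have "4 * \<eta> ^ M * (wnorm P2 z)\<^sup>2 \<le> \<mu> ^ M * (wnorm P1 z)\<^sup>2" if "Suc M0 \<le> M" for M z
  proof -
    have "4 * \<eta> ^ M * (wnorm P2 z)\<^sup>2 \<le> 4 * \<eta> ^ M * ((b * a)\<^sup>2 * (wnorm P1 z)\<^sup>2)"
      using eta by (intro mult_left_mono cmp) auto
    also have "\<dots> = (4 * (b * a)\<^sup>2 * \<eta> ^ M) * (wnorm P1 z)\<^sup>2"
      by simp
    also have "\<dots> \<le> \<mu> ^ M * (wnorm P1 z)\<^sup>2"
      using M0[of M] that mu by (intro mult_right_mono) (auto simp: power_divide field_simps)
    finally show ?thesis .
  qed
  with mu that[of \<mu> "Suc M0"] show ?thesis
    by simp
qed

lemma gp_mhe_robust_bound: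
  assumes X: "compact X" and U: "compact U"
    and f: "continuous_on (X \<times> U) (\<lambda>(x, u). f x u)"
    and h: "continuous_on (X \<times> U) (\<lambda>(x, u). h x u)"
    and "0 < M" "\<eta> \<le> \<mu>" "\<mu> < 1"
    and contr: "\<And>z. 4 * \<eta> ^ M * (wnorm P2 z)\<^sup>2 \<le> \<mu> ^ M * (wnorm P1 z)\<^sup>2"
    and traj: "system_trajectory f h X U x u w v y"
    and mhe: "gp_mhe gx gy D X \<eta> P2 Q0 R0 M u y xhat"
  shows "wnorm P1 (xhat t - x t) \<le>
    Max ({6 * sqrt \<mu> ^ t * wnorm P2 (xhat 0 - x 0)}
         \<union> (\<lambda>q. 12 / (1 - root 4 \<mu>) * root 4 \<mu> ^ q
                * wnorm (inv_weight_max Q0) (w (t - q - 1))) ` {..<t}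
         \<union> (\<lambda>q. 12 / (1 - root 4 \<mu>) * root 4 \<mu> ^ q
                * wnorm (inv_weight_max R0) (v (t - q - 1))) ` {..<t}
         \<union> {12 / (1 - root 4 \<mu>) *
              max (mismatch_max X U f gx D Q0) (mismatch_max X U h gy D R0)})"
proof -
  let ?c = "max (mismatch_max X U f gx D Q0) (mismatch_max X U h gy D R0)"
  let ?Q = "inv_weight_max Q0" and ?R = "inv_weight_max R0"
  have inX: "x j \<in> X" and inU: "u j \<in> U" and x: "x (Suc j) = f (x j) (u j) + w j"
    and y: "y j = h (x j) (u j) + v j" for j
    using traj by (auto simp: system_trajectory_def)
  have mu0: "0 \<le> \<mu>"
    using eta \<open>\<eta> \<le> \<mu>\<close> by simp
  note Q = sym_pos_def_inv_weight_max[OF Q0] and R = sym_pos_def_inv_weight_max[OF R0]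
  \<comment> \<open>Relative to the learned model, the disturbances of the true system are
    \<open>w + df\<close> and \<open>v + dh\<close>.\<close>
  define df where "df j = f (x j) (u j) - post_mean_vec gx D (stack (x j) (u j))" for j
  define dh where "dh j = h (x j) (u j) - post_mean_vec gy D (stack (x j) (u j))" for j
  have df: "wnorm ?Q (df j) \<le> ?c" and dh: "wnorm ?R (dh j) \<le> ?c" for j
    using mismatch_max_upper[OF X U f inX inU, of Q0 j j gx D]
      mismatch_max_upper[OF X U h inX inU, of R0 j j gy D]
    by (simp_all add: df_def dh_def)
  have c: "0 \<le> ?c"
    using wnorm_nonneg[OF Q] df by (rule order_trans)
  have "wnorm P1 (xhat t - x t) \<le> 2 * sqrt \<mu> ^ t * wnorm P2 (xhat 0 - x 0)
    + (\<Sum>i<t. sqrt \<mu> ^ i * (2 * (wnorm ?Q (w (t - Suc i) + df (t - Suc i))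
        + wnorm ?R (v (t - Suc i) + dh (t - Suc i)))))"
    by (rule gp_mhe_error_bound[OF mhe \<open>0 < M\<close> \<open>\<eta> \<le> \<mu>\<close> contr inX inU])
      (simp_all add: x y df_def dh_def)
  also have "\<dots> \<le> 2 * sqrt \<mu> ^ t * wnorm P2 (xhat 0 - x 0)
    + (\<Sum>i<t. sqrt \<mu> ^ i * (2 * (wnorm ?Q (w (t - Suc i)) + wnorm ?R (v (t - Suc i)) + 2 * ?c)))"
  proof (intro add_left_mono sum_mono mult_left_mono)
    show "wnorm ?Q (w (t - Suc i) + df (t - Suc i)) + wnorm ?R (v (t - Suc i) + dh (t - Suc i))
        \<le> wnorm ?Q (w (t - Suc i)) + wnorm ?R (v (t - Suc i)) + 2 * ?c" for i
      using wnorm_triangle[OF Q, of "w (t - Suc i)" "df (t - Suc i)"] df[of "t - Suc i"]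
        wnorm_triangle[OF R, of "v (t - Suc i)" "dh (t - Suc i)"] dh[of "t - Suc i"]
      by linarith
  qed (use mu0 in auto)
  \<comment> \<open>This brings the sum into the form of \<open>discounted_sum_le_Max\<close> with
    \<open>r = root 4 \<mu>\<close>.\<close>
  also have "sqrt \<mu> = (root 4 \<mu>)\<^sup>2"
    using mu0 real_root_mult_exp[of 2 2 \<mu>] by (simp add: sqrt_def)
  finally have "wnorm P1 (xhat t - x t) \<le> 2 * (((root 4 \<mu>)\<^sup>2) ^ t * wnorm P2 (xhat 0 - x 0))
    + (\<Sum>i<t. ((root 4 \<mu>)\<^sup>2) ^ i
        * (2 * (wnorm ?Q (w (t - Suc i)) + wnorm ?R (v (t - Suc i)) + 2 * ?c)))"
    by (simp add: mult.assoc)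
  from discounted_sum_le_Max[OF _ _ c _ _ this] show ?thesis
    using mu0 \<open>\<mu> < 1\<close> wnorm_nonneg[OF Q] wnorm_nonneg[OF R]
    by (simp add: \<open>sqrt \<mu> = (root 4 \<mu>)\<^sup>2\<close> mult.assoc)
qed

text \<open>Norm equivalence turns each weighted term into a Euclidean one. The maximum is attained,
  so it suffices to dominate each of its members by a member of the target set.\<close>

lemma pRES_if_weighted_bound:
  assumes "0 \<le> \<mu>" "\<mu> < 1"
    and bound: "\<And>x u w v y xhat t. system_trajectory f h X U x u w v y \<Longrightarrow> xhat 0 \<in> X \<Longrightarrow>
      est u y xhat \<Longrightarrow> wnorm P1 (xhat t - x t) \<le>
      Max ({6 * sqrt \<mu> ^ t * wnorm P2 (xhat 0 - x 0)}
         \<union> (\<lambda>q. 12 / (1 - root 4 \<mu>) * root 4 \<mu> ^ q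
                * wnorm (inv_weight_max Q0) (w (t - q - 1))) ` {..<t}
         \<union> (\<lambda>q. 12 / (1 - root 4 \<mu>) * root 4 \<mu> ^ q
                * wnorm (inv_weight_max R0) (v (t - q - 1))) ` {..<t}
         \<union> {12 / (1 - root 4 \<mu>) * c})"
  shows "pRES f h X U est"
proof -
  obtain a a' where a: "0 < a" "0 < a'" "\<And>z. norm z \<le> a * wnorm P1 z"
    "\<And>z. wnorm P1 z \<le> a' * norm z"
    by (rule wnorm_norm_bounds[OF P1], rule that)
  obtain b' b where b: "0 < b'" "0 < b" "\<And>z. norm z \<le> b' * wnorm P2 z"
    "\<And>z. wnorm P2 z \<le> b * norm z"
    by (rule wnorm_norm_bounds[OF P2], rule that)
  obtain bw' bw where bw: "0 < bw'" "0 < bw"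
    "\<And>z. norm z \<le> bw' * wnorm (inv_weight_max Q0) z"
    "\<And>z. wnorm (inv_weight_max Q0) z \<le> bw * norm z"
    by (rule wnorm_norm_bounds[OF sym_pos_def_inv_weight_max[OF Q0]], rule that)
  obtain bv' bv where bv: "0 < bv'" "0 < bv"
    "\<And>z. norm z \<le> bv' * wnorm (inv_weight_max R0) z"
    "\<And>z. wnorm (inv_weight_max R0) z \<le> bv * norm z"
    by (rule wnorm_norm_bounds[OF sym_pos_def_inv_weight_max[OF R0]], rule that)
  define r where "r = root 4 \<mu>"
  have r: "0 \<le> r" "r < 1"
    using assms by (simp_all add: r_def)
  define g where "g = 12 / (1 - r)"
  have g: "0 < g"
    using r by (simp add: g_def)
  \<comment> \<open>The absolute value and the added \<open>1\<close> make \<open>\<alpha>\<close>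
    positive for every real \<open>c\<close>.\<close>
  define C1 C2 C3 \<alpha>
    where "C1 = a * 6 * b" and "C2 = a * g * bw" and "C3 = a * g * bv" and "\<alpha> = \<bar>a * (g * c)\<bar> + 1"
  have "norm (x t - xhat t) \<le> Max ({C1 * norm (x 0 - xhat 0) * sqrt \<mu> ^ t}
      \<union> (\<lambda>j. C2 * norm (w j) * r ^ (t - j - 1)) ` {..<t}
      \<union> (\<lambda>j. C3 * norm (v j) * r ^ (t - j - 1)) ` {..<t} \<union> {\<alpha>})" (is "_ \<le> Max ?T")
    if "system_trajectory f h X U x u w v y" "xhat 0 \<in> X" "est u y xhat" for x u w v y xhat t
  proof -
    let ?S = "{6 * sqrt \<mu> ^ t * wnorm P2 (xhat 0 - x 0)}
         \<union> (\<lambda>q. g * r ^ q * wnorm (inv_weight_max Q0) (w (t - q - 1))) ` {..<t}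
         \<union> (\<lambda>q. g * r ^ q * wnorm (inv_weight_max R0) (v (t - q - 1))) ` {..<t} \<union> {g * c}"
    define m where "m = Max ?S"
    have "m \<in> ?S"
      unfolding m_def by (rule Max_in) auto
    then have "\<exists>s\<in>?T. a * m \<le> s"
    proof (elim UnE imageE singletonE)
      assume m: "m = 6 * sqrt \<mu> ^ t * wnorm P2 (xhat 0 - x 0)"
      have "a * m \<le> a * (6 * sqrt \<mu> ^ t * (b * norm (xhat 0 - x 0)))"
        unfolding m using a assms by (intro mult_left_mono b(4)) auto
      also have "\<dots> = C1 * norm (x 0 - xhat 0) * sqrt \<mu> ^ t"
        by (simp add: C1_def norm_minus_commute)
      finally show ?thesis
        by blast
    next
      fix q assume m: "m = g * r ^ q * wnorm (inv_weight_max Q0) (w (t - q - 1))" and q: "q \<in> {..<t}"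
      have "a * m \<le> a * (g * r ^ q * (bw * norm (w (t - q - 1))))"
        unfolding m using a g r by (intro mult_left_mono bw(4)) auto
      \<comment> \<open>The delay \<open>q\<close> corresponds to time \<open>j = t - q - 1\<close>,
        and \<open>t - j - 1\<close> is \<open>q\<close> again because \<open>q < t\<close>.\<close>
      also have "\<dots> = C2 * norm (w (t - q - 1)) * r ^ (t - (t - q - 1) - 1)"
        using q by (simp add: C2_def)
      finally have "a * m \<le> C2 * norm (w (t - q - 1)) * r ^ (t - (t - q - 1) - 1)" .
      moreover have "t - q - 1 \<in> {..<t}"
        using q by auto
      ultimately show ?thesis
        by blast
    next
      fix q assume m: "m = g * r ^ q * wnorm (inv_weight_max R0) (v (t - q - 1))" and q: "q \<in> {..<t}"
      have "a * m \<le> a * (g * r ^ q * (bv * norm (v (t - q - 1))))"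
        unfolding m using a g r by (intro mult_left_mono bv(4)) auto
      also have "\<dots> = C3 * norm (v (t - q - 1)) * r ^ (t - (t - q - 1) - 1)"
        using q by (simp add: C3_def)
      finally have "a * m \<le> C3 * norm (v (t - q - 1)) * r ^ (t - (t - q - 1) - 1)" .
      moreover have "t - q - 1 \<in> {..<t}"
        using q by auto
      ultimately show ?thesis
        by blast
    next
      assume "m = g * c"
      then have "a * m \<le> \<alpha>"
        by (simp add: \<alpha>_def)
      then show ?thesis
        by blast
    qed
    then obtain s where s: "s \<in> ?T" "a * m \<le> s" ..
    have "norm (x t - xhat t) \<le> a * wnorm P1 (xhat t - x t)"
      using a(3)[of "x t - xhat t"] by (simp add: wnorm_minus_commute[of P1 "x t"])
    also have "\<dots> \<le> a * m"
      using bound[OF that, of t] a(1) by (simp add: m_def g_def r_def)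
    also have "\<dots> \<le> Max ?T"
      using s(2) by (rule order_trans) (rule Max_ge, simp, rule s(1))
    finally show ?thesis .
  qed
  moreover have "0 < C1" "0 < C2" "0 < C3" "0 < \<alpha>"
    using a b bw bv g by (simp_all add: C1_def C2_def C3_def \<alpha>_def add_nonneg_pos)
  moreover have "sqrt \<mu> \<in> {0..<1}" "r \<in> {0..<1}"
    using assms r by simp_all
  ultimately have "0 < C1 \<and> 0 < C2 \<and> 0 < C3 \<and> sqrt \<mu> \<in> {0..<1} \<and> r \<in> {0..<1} \<and> r \<in> {0..<1} \<and> 0 < \<alpha> \<and>
      (\<forall>x u w v y xhat t. system_trajectory f h X U x u w v y \<longrightarrow> xhat 0 \<in> X \<longrightarrow> est u y xhat \<longrightarrow>
        norm (x t - xhat t) \<le> Max ({C1 * norm (x 0 - xhat 0) * sqrt \<mu> ^ t}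
          \<union> (\<lambda>j. C2 * norm (w j) * r ^ (t - j - 1)) ` {..<t}
          \<union> (\<lambda>j. C3 * norm (v j) * r ^ (t - j - 1)) ` {..<t} \<union> {\<alpha>}))"
    by (intro conjI allI impI)
  then show ?thesis
    unfolding pRES_def by (intro exI)
qed

end

theorem theorem1:
  fixes f :: "real^'n \<Rightarrow> real^'m \<Rightarrow> real^'n"
    and h :: "real^'n \<Rightarrow> real^'m \<Rightarrow> real^'p"
    and X :: "(real^'n) set" and U :: "(real^'m) set"
    and D :: "'N::finite \<Rightarrow> real^('n + 'm)"
    and gx :: "'n \<Rightarrow> ('n + 'm, 'N) gp" and gy :: "'p \<Rightarrow> ('n + 'm, 'N) gp"
    and W :: "real^'n \<Rightarrow> real^'n \<Rightarrow> real" and \<eta> :: real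
    and P1 P2 Q0 :: "real^'n^'n" and R0 :: "real^'p^'p"
  assumes "compact X" "X \<noteq> {}" "compact U" "U \<noteq> {}"
    and "continuous_on (X \<times> U) (\<lambda>(x, u). f x u)"
    and "continuous_on (X \<times> U) (\<lambda>(x, u). h x u)"
    and "\<And>i. gp_admissible (gx i) D" "\<And>j. gp_admissible (gy j) D"
    and "\<eta> \<in> {0..<1}"
    and "sym_pos_def P1" "sym_pos_def P2" "sym_pos_def Q0" "sym_pos_def R0"
    and "\<And>x x'. W x x' \<ge> 0"
    and "\<And>x x'. x \<in> X \<Longrightarrow> x' \<in> X \<Longrightarrow>
           (wnorm P1 (x - x'))\<^sup>2 \<le> W x x' \<and> W x x' \<le> (wnorm P2 (x - x'))\<^sup>2"
    and "\<And>x x' u w w'. x \<in> X \<Longrightarrow> x' \<in> X \<Longrightarrow> u \<in> U \<Longrightarrow>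
           W (post_mean_vec gx D (stack x u) + w) (post_mean_vec gx D (stack x' u) + w')
           \<le> \<eta> * W x x'
             + (wnorm (inv_weight_min gx Q0) (w - w'))\<^sup>2
             + (wnorm (inv_weight_min gy R0)
                  (post_mean_vec gy D (stack x u) - post_mean_vec gy D (stack x' u)))\<^sup>2"
  shows "\<exists>\<mu>\<in>{0..<1}. \<exists>Mbar :: nat. \<forall>M\<ge>Mbar.
           (\<forall>x u w v y xhat t.
              system_trajectory f h X U x u w v y \<longrightarrow> xhat 0 \<in> X \<longrightarrow>
              gp_mhe gx gy D X \<eta> P2 Q0 R0 M u y xhat \<longrightarrow>
              wnorm P1 (xhat t - x t) \<le>
                Max ({6 * sqrt \<mu> ^ t * wnorm P2 (xhat 0 - x 0)}
                     \<union> (\<lambda>q. 12 / (1 - root 4 \<mu>) * root 4 \<mu> ^ q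
                            * wnorm (inv_weight_max Q0) (w (t - q - 1))) ` {..<t}
                     \<union> (\<lambda>q. 12 / (1 - root 4 \<mu>) * root 4 \<mu> ^ q
                            * wnorm (inv_weight_max R0) (v (t - q - 1))) ` {..<t}
                     \<union> {12 / (1 - root 4 \<mu>) *
                          max (mismatch_max X U f gx D Q0) (mismatch_max X U h gy D R0)}))
           \<and> pRES f h X U (gp_mhe gx gy D X \<eta> P2 Q0 R0 M)"
proof -
  interpret detectable_gp_model X U D gx gy W \<eta> P1 P2 Q0 R0
    by unfold_locales (fact assms)+
  \<comment> \<open>Rate and minimal horizon are obtained before \<open>M\<close> is fixed, so one
    \<open>\<mu>\<close> serves all horizon lengths.\<close>
  obtain \<mu> M0 where mu: "\<eta> \<le> \<mu>" "0 < \<mu>" "\<mu> < 1" and M0: "0 < M0"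
    and contr: "\<And>M z. M0 \<le> M \<Longrightarrow> 4 * \<eta> ^ M * (wnorm P2 z)\<^sup>2 \<le> \<mu> ^ M * (wnorm P1 z)\<^sup>2"
    by (rule contraction_rate, rule that)
  show ?thesis
  proof (rule bexI, rule exI, intro allI impI)
    show "\<mu> \<in> {0..<1}"
      using mu by simp
    fix M assume M: "M0 \<le> M"
    note bound = gp_mhe_robust_bound[OF assms(1,3,5,6) less_le_trans[OF M0 M] mu(1,3) contr[OF M]]
    have "pRES f h X U (gp_mhe gx gy D X \<eta> P2 Q0 R0 M)"
      by (rule pRES_if_weighted_bound[OF less_imp_le[OF mu(2)] mu(3)]) (rule bound)
    then show "(\<forall>x u w v y xhat t.
              system_trajectory f h X U x u w v y \<longrightarrow> xhat 0 \<in> X \<longrightarrow>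
              gp_mhe gx gy D X \<eta> P2 Q0 R0 M u y xhat \<longrightarrow>
              wnorm P1 (xhat t - x t) \<le>
                Max ({6 * sqrt \<mu> ^ t * wnorm P2 (xhat 0 - x 0)}
                     \<union> (\<lambda>q. 12 / (1 - root 4 \<mu>) * root 4 \<mu> ^ q
                            * wnorm (inv_weight_max Q0) (w (t - q - 1))) ` {..<t}
                     \<union> (\<lambda>q. 12 / (1 - root 4 \<mu>) * root 4 \<mu> ^ q
                            * wnorm (inv_weight_max R0) (v (t - q - 1))) ` {..<t}
                     \<union> {12 / (1 - root 4 \<mu>) *
                          max (mismatch_max X U f gx D Q0) (mismatch_max X U h gy D R0)}))
           \<and> pRES f h X U (gp_mhe gx gy D X \<eta> P2 Q0 R0 M)"
      by (intro conjI allI impI) (rule bound)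
  qed
qed

end
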